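(* Let $0<b<\infty$, $h\in\mathbb R$, and for $\nu\in[0,1)$ let $A_{\nu,b}$ be the Bessel operator in $L^2(0,b)$ acting as $\tau_\nu=-\frac{d^2}{dx^2}+\frac{\nu^2-1/4}{x^2}$ on the domain $\{f\in H^2[0,b]: f(0)=f'(0)=f(b)=0\}$. Let $(A_{\nu,b})_h=A_{\nu,b}^*\upharpoonright\ker(\Gamma_1^{\nu,b}-h\Gamma_0^{\nu,b})$, where $\Gamma_0^{\nu,b}f=[f,x^{1/2+\nu}]_0$ and $\Gamma_1^{\nu,b}f=-(2\nu)^{-1}[f,x^{1/2-\nu}]_0$ if $\nu\in(0,1)$, $\Gamma_1^{0,b}f=[f,x^{1/2}\log(x)]_0$ if $\nu=0$. Then: (i) For $\nu\in(0,1)$, the extension $(A_{\nu,b})_h$ is non-negative if and only if $h\ge-\dfrac{b^{-2\nu}}{2\nu}$. (ii) For $\nu=0$, the extension $(A_{0,b})_h$ is non-negative if and only if $h\ge\log(b)$.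
   Context: $[f,g]_x=f(x)\overline{g'(x)}-f'(x)\overline{g(x)}$ and $[f,g]_0=\lim_{x\to0^+}[f,g]_x$. The maps $\Gamma_0^{\nu,b},\Gamma_1^{\nu,b}:\operatorname{dom}(A_{\nu,b}^* )\to\mathbb C$ form a boundary triplet for $A_{\nu,b}^*$, i.e. $(A_{\nu,b}^*f,g)-(f,A_{\nu,b}^*g)=\Gamma_1^{\nu,b}f\,\overline{\Gamma_0^{\nu,b}g}-\Gamma_0^{\nu,b}f\,\overline{\Gamma_1^{\nu,b}g}$ and $(\Gamma_0^{\nu,b},\Gamma_1^{\nu,b})$ is surjective onto $\mathbb C^2$. *)

theory Defs
  imports "HOL-Analysis.Analysis"
begin

text \<open>
  Elements of \<open>L\<^sup>2(0,b)\<close> are represented by functions \<open>real \<Rightarrow> complex\<close>, of which only the values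
  at almost every point of \<open>(0,b)\<close> matter. An operator in \<open>L\<^sup>2(0,b)\<close> is given by its graph, a set of
  pairs closed under almost everywhere equality in both components.
\<close>

type_synonym op_graph = "((real \<Rightarrow> complex) \<times> (real \<Rightarrow> complex)) set"

definition L2 :: "real \<Rightarrow> (real \<Rightarrow> complex) set" where
  "L2 b = {f. f \<in> borel_measurable (lebesgue_on {0<..<b}) \<and>
              integrable (lebesgue_on {0<..<b}) (\<lambda>x. (cmod (f x))\<^sup>2)}"

definition ip :: "real \<Rightarrow> (real \<Rightarrow> complex) \<Rightarrow> (real \<Rightarrow> complex) \<Rightarrow> complex" where
  "ip b f g = integral\<^sup>L (lebesgue_on {0<..<b}) (\<lambda>x. f x * cnj (g x))"

definition adjoint_graph :: "real \<Rightarrow> op_graph \<Rightarrow> op_graph" where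
  "adjoint_graph b T =
     {(f, g). f \<in> L2 b \<and> g \<in> L2 b \<and> (\<forall>(u, v)\<in>T. ip b v f = ip b u g)}"

definition nonneg_op :: "real \<Rightarrow> op_graph \<Rightarrow> bool" where
  "nonneg_op b T \<longleftrightarrow> (\<forall>(f, g)\<in>T. ip b g f \<in> \<real>\<^sub>\<ge>\<^sub>0)"

text \<open>
  \<open>H2_fun b \<phi> \<phi>1 \<phi>2\<close>: the function \<open>\<phi>\<close> belongs to \<open>H\<^sup>2[0,b]\<close>, that is, it is differentiable on
  \<open>[0,b]\<close>, its derivative \<open>\<phi>1\<close> is absolutely continuous (an indefinite Lebesgue integral), and its
  almost everywhere second derivative \<open>\<phi>2\<close> is square integrable.
\<close>

definition H2_fun ::
    "real \<Rightarrow> (real \<Rightarrow> complex) \<Rightarrow> (real \<Rightarrow> complex) \<Rightarrow> (real \<Rightarrow> complex) \<Rightarrow> bool" where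
  "H2_fun b \<phi> \<phi>1 \<phi>2 \<longleftrightarrow>
     (\<forall>x\<in>{0..b}. (\<phi> has_vector_derivative \<phi>1 x) (at x within {0..b})) \<and>
     \<phi>2 \<in> L2 b \<and>
     (\<forall>x\<in>{0..b}. \<phi>1 x = \<phi>1 0 + integral\<^sup>L (lebesgue_on {0<..<x}) \<phi>2)"

text \<open>
  The operator \<open>A\<^sub>\<nu>\<^sub>,\<^sub>b\<close>. No condition that the image lie in \<open>L\<^sup>2(0,b)\<close> is imposed, since by Hardy's
  inequality it always does: \<open>\<phi>(x)/x\<^sup>2\<close> is square integrable if \<open>\<phi>(0) = \<phi>'(0) = 0\<close>.
\<close>

definition bessel_min :: "real \<Rightarrow> real \<Rightarrow> op_graph" where
  "bessel_min \<nu> b =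
     {(f, g). \<exists>\<phi> \<phi>1 \<phi>2. H2_fun b \<phi> \<phi>1 \<phi>2 \<and> \<phi> 0 = 0 \<and> \<phi>1 0 = 0 \<and> \<phi> b = 0 \<and>
        (AE x in lebesgue_on {0<..<b}. f x = \<phi> x) \<and>
        (AE x in lebesgue_on {0<..<b}.
           g x = - \<phi>2 x + complex_of_real ((\<nu>\<^sup>2 - 1/4) / x\<^sup>2) * \<phi> x)}"

text \<open>
  The boundary values of a class are those of its continuously differentiable representative, which
  is unique on \<open>(0,b)\<close> whenever it exists; it exists for every element of the domain of
  \<open>A\<^sub>\<nu>\<^sub>,\<^sub>b\<^sup>*\<close>. The values of the chosen function outside \<open>(0,b)\<close> play no role.
\<close>

definition C1_rep :: "real \<Rightarrow> (real \<Rightarrow> complex) \<Rightarrow> real \<Rightarrow> complex" where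
  "C1_rep b f = (SOME \<phi>. \<phi> C1_differentiable_on {0<..<b} \<and>
                         (AE x in lebesgue_on {0<..<b}. f x = \<phi> x))"

definition bracket :: "(real \<Rightarrow> complex) \<Rightarrow> (real \<Rightarrow> complex) \<Rightarrow> real \<Rightarrow> complex" where
  "bracket f g x =
     f x * cnj (vector_derivative g (at x)) - vector_derivative f (at x) * cnj (g x)"

definition bracket0 :: "(real \<Rightarrow> complex) \<Rightarrow> (real \<Rightarrow> complex) \<Rightarrow> complex" where
  "bracket0 f g = Lim (at_right 0) (bracket f g)"

definition Gamma0 :: "real \<Rightarrow> real \<Rightarrow> (real \<Rightarrow> complex) \<Rightarrow> complex" where
  "Gamma0 \<nu> b f = bracket0 (C1_rep b f) (\<lambda>x. complex_of_real (x powr (1/2 + \<nu>)))"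

definition Gamma1 :: "real \<Rightarrow> real \<Rightarrow> (real \<Rightarrow> complex) \<Rightarrow> complex" where
  "Gamma1 \<nu> b f =
     (if \<nu> = 0 then bracket0 (C1_rep b f) (\<lambda>x. complex_of_real (x powr (1/2) * ln x))
      else - complex_of_real (1 / (2 * \<nu>)) *
             bracket0 (C1_rep b f) (\<lambda>x. complex_of_real (x powr (1/2 - \<nu>))))"

definition bessel_ext :: "real \<Rightarrow> real \<Rightarrow> real \<Rightarrow> op_graph" where
  "bessel_ext \<nu> b h =
     {(f, g) \<in> adjoint_graph b (bessel_min \<nu> b).
        Gamma1 \<nu> b f - complex_of_real h * Gamma0 \<nu> b f = 0}"

end

theory Submission
  imports Defs
begin

text \<open>
  For \<open>0 \<le> \<nu> < 1\<close> let \<open>F = x\<^bsup>1/2+\<nu>\<^esup>\<close>, and let \<open>G = x\<^bsup>1/2-\<nu>\<^esup> / (2\<nu>)\<close>, or \<open>G = -x\<^bsup>1/2\<^esup> log x\<close> if \<open>\<nu> = 0\<close>.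
  Both solve \<open>\<tau>\<^sub>\<nu> y = 0\<close>, and they are normalised by \<open>G F' - G' F = 1\<close>. In these terms
  \<open>\<Gamma>\<^sub>0 f = [f, F]\<^sub>0\<close> and \<open>\<Gamma>\<^sub>1 f = -[f, G]\<^sub>0\<close> for every \<open>\<nu>\<close>, so the two parts of the theorem are one claim:
  the extension is non-negative iff \<open>h \<ge> -\<kappa>\<close> with \<open>\<kappa> = G(b) / F(b)\<close> (\<open>nonneg_iff\<close>).

  Variation of parameters takes the place of asymptotic analysis at \<open>0\<close>. The domain of the adjoint
  consists of the functions \<open>f = F p + G r\<close> with \<open>p' = -G g\<close>, \<open>r' = F g\<close> and \<open>f(b) = 0\<close>, where
  \<open>g = A\<^sup>* f\<close> (\<open>sol_in_adjoint\<close>, \<open>adjoint_domain\<close>). Since \<open>F\<close> and \<open>G\<close> are square integrable, \<open>p\<close> and \<open>r\<close> are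
  absolutely continuous up to \<open>0\<close>. Since \<open>r = [f, F]\<close> and \<open>p = -[f, G]\<close> at every point, \<open>\<Gamma>\<^sub>0 f = r(0)\<close> and
  \<open>\<Gamma>\<^sub>1 f = p(0)\<close> (\<open>boundary_values\<close>).

  Let \<open>w = G - \<kappa> F\<close>, the solution that is positive on \<open>(0,b)\<close> and vanishes at \<open>b\<close>, and let
  \<open>m = p + \<kappa> r\<close>, which is the Wronskian of \<open>w\<close> and \<open>f\<close>. Then \<open>m' = -w g\<close> and \<open>m(b) = 0\<close>, and the boundary
  condition \<open>\<Gamma>\<^sub>1 f = h \<Gamma>\<^sub>0 f\<close> gives \<open>m(0) = (h + \<kappa>) \<Gamma>\<^sub>0 f\<close>. Integration by parts (\<open>form_value\<close>) yields
  \<open>(A\<^sup>* f, f) = (h + \<kappa>) |\<Gamma>\<^sub>0 f|\<^sup>2 + 2 \<integral> F Re (g cnj m)\<close>,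
  and the integral is non-negative (\<open>form_nonneg\<close>): as \<open>(F/w)' = 1/w\<^sup>2\<close> and \<open>(|m|\<^sup>2)' = -2 w Re (g cnj m)\<close>,
  another integration by parts turns \<open>2 \<integral> F Re (g cnj m)\<close> into \<open>\<integral> |m|\<^sup>2 / w\<^sup>2\<close>. So \<open>h \<ge> -\<kappa>\<close> suffices.

  If \<open>h < -\<kappa>\<close>, take for \<open>g\<close> the indicator function of a short interval \<open>(0,d)\<close>. With \<open>M = \<integral> w g\<close> the first
  term is \<open>-M\<^sup>2 / |h + \<kappa>|\<close>, and the second is at most \<open>2 M \<integral> F g\<close>. As \<open>F/w\<close> tends to \<open>0\<close> at \<open>0\<close>, the first one
  dominates for small \<open>d\<close>, and the form takes a negative value (\<open>not_nonneg_if\<close>).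
\<close>

section \<open>Indefinite integrals and integration by parts\<close>

lemma absolutely_integrable_mult_continuous:
  fixes a H :: "real \<Rightarrow> complex"
  assumes H: "continuous_on {s..t} H" and a: "a absolutely_integrable_on {s..t}"
  shows "(\<lambda>x. H x * a x) absolutely_integrable_on {s..t}" "(\<lambda>x. a x * H x) absolutely_integrable_on {s..t}"
proof -
  have "(\<lambda>x. H x * a x) absolutely_integrable_on {s..t}"
    by (rule absolutely_integrable_bounded_measurable_product[of "(*)"])
       (auto intro!: bilinear_times H a continuous_imp_measurable_on_sets_lebesgue compact_imp_bounded compact_continuous_image)
  then show "(\<lambda>x. H x * a x) absolutely_integrable_on {s..t}" "(\<lambda>x. a x * H x) absolutely_integrable_on {s..t}"
    by (simp_all add: mult.commute)
qed

text \<open>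
  Both sides are the integral of \<open>a x * c y\<close> over the triangle \<open>s \<le> y \<le> x \<le> t\<close>. This is integration
  by parts for functions that are differentiable only almost everywhere.
\<close>

lemma Fubini_triangle:
  fixes a c :: "real \<Rightarrow> complex"
  assumes a: "a absolutely_integrable_on {s..t}" and c: "c absolutely_integrable_on {s..t}"
  shows "integral {s..t} (\<lambda>x. a x * integral {s..x} c) = integral {s..t} (\<lambda>y. integral {y..t} a * c y)"
proof -
  define M where "M = lebesgue_on {s..t}"
  interpret finite_measure M
    unfolding M_def by (rule finite_measure_lebesgue_on) auto
  interpret P: pair_sigma_finite M M ..
  have aM: "integrable M a" and cM: "integrable M c"
    using a c unfolding M_def by (simp_all add: absolutely_integrable_imp_integrable)
  have [measurable]: "a \<in> borel_measurable M" "c \<in> borel_measurable M"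
    using aM cM by auto
  have [measurable]: "(\<lambda>x. x) \<in> borel_measurable M"
    unfolding M_def by (intro continuous_imp_measurable_on_sets_lebesgue) (auto intro: continuous_intros)
  have "integrable (M \<Otimes>\<^sub>M M) (\<lambda>(x, y). a x * c y)"
    by (rule P.Fubini_integrable) (use aM cM in \<open>auto simp: norm_mult\<close>)
  then have "integrable (M \<Otimes>\<^sub>M M) (\<lambda>(x, y). if y \<le> x then a x * c y else 0)"
    by (rule Bochner_Integration.integrable_bound) (auto simp: norm_mult)
  then have Fub: "(LINT x|M. LINT y|M. (if y \<le> x then a x * c y else 0))
      = (LINT y|M. LINT x|M. (if y \<le> x then a x * c y else 0))"
    by (intro P.Fubini_integral[symmetric]) (simp add: case_prod_beta')
  have inner: "(LINT y|M. (if y \<le> x then a x * c y else 0)) = a x * integral {s..x} c" if "x \<in> {s..t}" for x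
  proof -
    have "(LINT y|M. (if y \<le> x then a x * c y else 0)) = a x * (LINT y|M. (if y \<in> {..x} then c y else 0))"
      by (simp flip: integral_mult_right_zero add: if_distrib[of "(*) (a x)"] cong: if_cong)
    also have "(LINT y|M. (if y \<in> {..x} then c y else 0)) = integral {s..t} (\<lambda>y. if y \<in> {..x} then c y else 0)"
      unfolding M_def
      by (rule lebesgue_integral_eq_integral, fold M_def, rule Bochner_Integration.integrable_bound[OF cM]) auto
    also have "\<dots> = integral {s..x} c"
      unfolding integral_restrict_Int using that by (intro arg_cong2[where f=integral]) auto
    finally show ?thesis .
  qed
  have outer: "(LINT x|M. (if y \<le> x then a x * c y else 0)) = integral {y..t} a * c y" if "y \<in> {s..t}" for y
  proof -
    have "(LINT x|M. (if y \<le> x then a x * c y else 0)) = (LINT x|M. (if x \<in> {y..} then a x else 0)) * c y"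
      by (simp flip: integral_mult_left_zero add: if_distrib[of "\<lambda>z. z * c y"] cong: if_cong)
    also have "(LINT x|M. (if x \<in> {y..} then a x else 0)) = integral {s..t} (\<lambda>x. if x \<in> {y..} then a x else 0)"
      unfolding M_def
      by (rule lebesgue_integral_eq_integral, fold M_def, rule Bochner_Integration.integrable_bound[OF aM]) auto
    also have "\<dots> = integral {y..t} a"
      unfolding integral_restrict_Int using that by (intro arg_cong2[where f=integral]) auto
    finally show ?thesis .
  qed
  have "(LINT x|M. a x * integral {s..x} c) = (LINT x|M. LINT y|M. (if y \<le> x then a x * c y else 0))"
    using inner by (intro Bochner_Integration.integral_cong) (auto simp: M_def)
  also have "\<dots> = (LINT y|M. integral {y..t} a * c y)"
    unfolding Fub using outer by (intro Bochner_Integration.integral_cong) (auto simp: M_def)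
  finally have "(LINT x|M. a x * integral {s..x} c) = (LINT y|M. integral {y..t} a * c y)" .
  moreover have "(\<lambda>x. a x * integral {s..x} c) absolutely_integrable_on {s..t}"
    "(\<lambda>y. integral {y..t} a * c y) absolutely_integrable_on {s..t}"
    using a c
    by (auto intro!: absolutely_integrable_mult_continuous(2)[OF _ a] absolutely_integrable_mult_continuous(1)[OF _ c]
        indefinite_integral_continuous_1 indefinite_integral_continuous_1' set_lebesgue_integral_eq_integral(1))
  ultimately show ?thesis
    by (simp add: M_def lebesgue_integral_eq_integral absolutely_integrable_imp_integrable)
qed

text \<open>
  \<open>A\<close> is absolutely continuous on \<open>[s,t]\<close> with density \<open>a\<close>. Carrying the density along avoids
  derivatives that exist only almost everywhere.
\<close>

definition AC_on :: "real \<Rightarrow> real \<Rightarrow> (real \<Rightarrow> complex) \<Rightarrow> (real \<Rightarrow> complex) \<Rightarrow> bool" where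
  "AC_on s t A a \<longleftrightarrow> a absolutely_integrable_on {s..t} \<and> (\<forall>x\<in>{s..t}. A x = A s + integral {s..x} a)"

lemma AC_on_integrable: "AC_on s t A a \<Longrightarrow> a absolutely_integrable_on {s..t}"
  unfolding AC_on_def by simp

lemma AC_on_eq: "AC_on s t A a \<Longrightarrow> x \<in> {s..t} \<Longrightarrow> A x = A s + integral {s..x} a"
  unfolding AC_on_def by blast

lemma AC_on_continuous:
  assumes "AC_on s t A a"
  shows "continuous_on {s..t} A"
proof -
  have "continuous_on {s..t} (\<lambda>x. A s + integral {s..x} a)"
    using AC_on_integrable[OF assms]
    by (intro continuous_intros indefinite_integral_continuous_1 set_lebesgue_integral_eq_integral(1))
  then show ?thesis
    by (rule continuous_on_eq) (rule AC_on_eq[OF assms, symmetric])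
qed

lemma AC_on_integral:
  assumes "AC_on s t A a" "s \<le> x" "x \<le> y" "y \<le> t"
  shows "integral {x..y} a = A y - A x"
proof -
  have "a integrable_on {s..y}"
    using assms(2-4) set_lebesgue_integral_eq_integral(1)[OF AC_on_integrable[OF assms(1)]]
    by (auto intro: integrable_on_subinterval)
  then have "integral {s..x} a + integral {x..y} a = integral {s..y} a"
    using assms by (intro Henstock_Kurzweil_Integration.integral_combine) auto
  moreover have "A x = A s + integral {s..x} a" "A y = A s + integral {s..y} a"
    using assms(2-4) by (auto intro!: AC_on_eq[OF assms(1)])
  ultimately show ?thesis by (simp add: algebra_simps)
qed

lemma AC_on_subinterval:
  assumes "AC_on s t A a" "s \<le> s'" "t' \<le> t"
  shows "AC_on s' t' A a"
  unfolding AC_on_def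
proof (intro conjI ballI)
  show "a absolutely_integrable_on {s'..t'}"
    using assms(2,3) by (intro absolutely_integrable_on_subinterval[OF AC_on_integrable[OF assms(1)]]) auto
  show "A x = A s' + integral {s'..x} a" if "x \<in> {s'..t'}" for x
    using AC_on_integral[OF assms(1), of s' x] that assms by auto
qed

lemma AC_on_mult:
  assumes A: "AC_on s t A a" and C: "AC_on s t C c"
  shows "AC_on s t (\<lambda>x. A x * C x) (\<lambda>x. a x * C x + A x * c x)"
  unfolding AC_on_def
proof (intro conjI ballI)
  have aC: "(\<lambda>x. a x * C x) absolutely_integrable_on {s..t}" and Ac: "(\<lambda>x. A x * c x) absolutely_integrable_on {s..t}"
    using absolutely_integrable_mult_continuous(2)[OF AC_on_continuous[OF C] AC_on_integrable[OF A]]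
      absolutely_integrable_mult_continuous(1)[OF AC_on_continuous[OF A] AC_on_integrable[OF C]] by auto
  then show "(\<lambda>x. a x * C x + A x * c x) absolutely_integrable_on {s..t}"
    by (rule set_integral_add)
  show "A x * C x = A s * C s + integral {s..x} (\<lambda>x. a x * C x + A x * c x)" if x: "x \<in> {s..t}" for x
  proof -
    have A': "AC_on s x A a" and C': "AC_on s x C c"
      using x by (auto intro: AC_on_subinterval[OF A] AC_on_subinterval[OF C])
    note int = AC_on_integrable[OF A'] AC_on_integrable[OF C']
    have aC: "(\<lambda>x. a x * C x) integrable_on {s..x}" and Ac: "(\<lambda>x. A x * c x) integrable_on {s..x}"
      using aC Ac x by (auto simp: absolutely_integrable_on_def intro: integrable_on_subinterval)
    have "integral {s..x} (\<lambda>y. a y * (C y - C s)) = integral {s..x} (\<lambda>y. (A x - A y) * c y)"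
    proof -
      have "integral {s..x} (\<lambda>y. a y * (C y - C s)) = integral {s..x} (\<lambda>y. a y * integral {s..y} c)"
        by (rule Henstock_Kurzweil_Integration.integral_cong) (simp add: AC_on_integral[OF C'])
      also have "\<dots> = integral {s..x} (\<lambda>y. integral {y..x} a * c y)"
        by (rule Fubini_triangle[OF int])
      also have "\<dots> = integral {s..x} (\<lambda>y. (A x - A y) * c y)"
        by (rule Henstock_Kurzweil_Integration.integral_cong) (simp add: AC_on_integral[OF A'])
      finally show ?thesis .
    qed
    also have "integral {s..x} (\<lambda>y. a y * (C y - C s)) = integral {s..x} (\<lambda>y. a y * C y) - (A x - A s) * C s"
      using aC set_lebesgue_integral_eq_integral(1)[OF int(1)] x
      by (simp add: right_diff_distrib Henstock_Kurzweil_Integration.integral_diff integrable_on_mult_left AC_on_integral[OF A'])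
    also have "integral {s..x} (\<lambda>y. (A x - A y) * c y) = A x * (C x - C s) - integral {s..x} (\<lambda>y. A y * c y)"
      using Ac set_lebesgue_integral_eq_integral(1)[OF int(2)] x
      by (simp add: left_diff_distrib Henstock_Kurzweil_Integration.integral_diff integrable_on_mult_right AC_on_integral[OF C'])
    finally show ?thesis
      using aC Ac by (simp add: Henstock_Kurzweil_Integration.integral_add algebra_simps)
  qed
qed

lemma AC_on_add:
  assumes A: "AC_on s t A a" and C: "AC_on s t C c"
  shows "AC_on s t (\<lambda>x. A x + C x) (\<lambda>x. a x + c x)"
  unfolding AC_on_def
proof (intro conjI ballI)
  show "(\<lambda>x. a x + c x) absolutely_integrable_on {s..t}"
    using A C by (intro set_integral_add AC_on_integrable)
  show "A x + C x = A s + C s + integral {s..x} (\<lambda>x. a x + c x)" if x: "x \<in> {s..t}" for x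
  proof -
    have "AC_on s x A a" "AC_on s x C c"
      using x by (auto intro: AC_on_subinterval[OF A] AC_on_subinterval[OF C])
    then have "a integrable_on {s..x}" "c integrable_on {s..x}"
      by (auto dest: AC_on_integrable simp: absolutely_integrable_on_def)
    then show ?thesis
      using x AC_on_integral[OF A, of s x] AC_on_integral[OF C, of s x]
      by (simp add: Henstock_Kurzweil_Integration.integral_add)
  qed
qed

lemma AC_on_cnj:
  assumes A: "AC_on s t A a"
  shows "AC_on s t (\<lambda>x. cnj (A x)) (\<lambda>x. cnj (a x))"
  unfolding AC_on_def
proof (intro conjI ballI)
  show "(\<lambda>x. cnj (a x)) absolutely_integrable_on {s..t}"
    using absolutely_integrable_linear[OF AC_on_integrable[OF A] bounded_linear_cnj] by (simp add: o_def)
  show "cnj (A x) = cnj (A s) + integral {s..x} (\<lambda>x. cnj (a x))" if x: "x \<in> {s..t}" for x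
    using AC_on_integral[OF A, of s x] x by (simp flip: integral_cnj)
qed

lemma AC_on_const: "AC_on s t (\<lambda>x. k) (\<lambda>x. 0)"
  by (simp add: AC_on_def)

lemma AC_on_cmult:
  assumes A: "AC_on s t A a"
  shows "AC_on s t (\<lambda>x. k * A x) (\<lambda>x. k * a x)"
  using AC_on_mult[OF AC_on_const[of s t k] A] by simp

lemma AC_on_diff:
  assumes A: "AC_on s t A a" and C: "AC_on s t C c"
  shows "AC_on s t (\<lambda>x. A x - C x) (\<lambda>x. a x - c x)"
  using AC_on_add[OF A AC_on_cmult[OF C, of "-1"]] by simp

lemma AC_on_C1:
  assumes "\<And>x. x \<in> {s..t} \<Longrightarrow> (A has_vector_derivative a x) (at x within {s..t})"
    and "continuous_on {s..t} a"
  shows "AC_on s t A a"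
  unfolding AC_on_def
proof (intro conjI ballI)
  show "a absolutely_integrable_on {s..t}"
    by (intro absolutely_integrable_continuous_real assms)
  show "A x = A s + integral {s..x} a" if "x \<in> {s..t}" for x
  proof -
    have "(a has_integral (A x - A s)) {s..x}"
      proof (rule fundamental_theorem_of_calculus)
        show "(A has_vector_derivative a y) (at y within {s..x})" if "y \<in> {s..x}" for y
          using \<open>x \<in> {s..t}\<close> that by (intro has_vector_derivative_within_subset[OF assms(1)]) auto
      qed (use that in auto)
    then show ?thesis by (simp add: integral_unique)
  qed
qed

lemma AC_on_has_vector_derivative:
  assumes A: "AC_on s t A a" and "continuous_on {s..t} a" "x \<in> {s..t}"
  shows "(A has_vector_derivative a x) (at x within {s..t})"
proof -
  have "((\<lambda>u. A s + integral {s..u} a) has_vector_derivative a x) (at x within {s..t})"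
    using integral_has_vector_derivative[OF assms(2,3)] by (auto intro!: derivative_eq_intros)
  then show ?thesis
    by (rule has_vector_derivative_transform[rotated 2, OF _ assms(3)]) (rule AC_on_eq[OF A])
qed

text \<open>
  This removes a singularity at the left end point: solutions of the Bessel equation are smooth on
  each \<open>[e,b]\<close> with \<open>e > 0\<close>, but not on \<open>[0,b]\<close>.
\<close>

lemma AC_on_extend_left:
  assumes "s < t"
    and AC: "\<And>e. s < e \<Longrightarrow> e < t \<Longrightarrow> AC_on e t A a"
    and a: "a absolutely_integrable_on {s..t}"
    and lim: "(A \<longlongrightarrow> A s) (at_right s)"
  shows "AC_on s t A a"
proof -
  have aint: "a integrable_on {s..t}" using a by (simp add: absolutely_integrable_on_def)
  define I where "I x = integral {s..x} a" for x
  have I: "I y - I x = A y - A x" if "s < x" "x \<le> y" "y \<le> t" for x y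
  proof -
    have "I x + integral {x..y} a = I y"
      unfolding I_def using that aint
      by (intro Henstock_Kurzweil_Integration.integral_combine integrable_on_subinterval[OF aint]) auto
    moreover have "integral {x..y} a = A y - A x"
    proof (cases "x < t")
      case True then show ?thesis using AC_on_integral[OF AC[of x], of x y] that by auto
    next
      case False
      then have "x = y" using that by simp
      then show ?thesis by simp
    qed
    ultimately show ?thesis by (simp add: algebra_simps)
  qed
  have "continuous_on {s..t} I"
    unfolding I_def by (rule indefinite_integral_continuous_1[OF aint])
  then have "(I \<longlongrightarrow> I s) (at s within {s..t})"
    using \<open>s < t\<close> by (auto simp: continuous_on_def)
  then have lI: "(I \<longlongrightarrow> 0) (at_right s)"
    using \<open>s < t\<close> by (simp add: at_within_Icc_at_right I_def)
  have *: "A x = A s + I x" if "s \<le> x" "x \<le> t" for x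
  proof (cases "x = s")
    case False
    have "((\<lambda>y. A x - A y + I y) \<longlongrightarrow> A x - A s + 0) (at_right s)"
      by (intro tendsto_intros lim lI)
    moreover have "\<forall>\<^sub>F y in at_right s. A x - A y + I y = I x"
      using eventually_at_right_real[of s x] False that
      by (auto elim!: eventually_mono simp: I[symmetric])
    ultimately have "((\<lambda>y. I x) \<longlongrightarrow> A x - A s) (at_right s)"
      by (simp add: filterlim_cong)
    then show ?thesis
      by (simp add: tendsto_const_iff)
  qed (simp add: I_def)
  show ?thesis
    unfolding AC_on_def
  proof (intro conjI ballI)
    show "A x = A s + integral {s..x} a" if "x \<in> {s..t}" for x
      unfolding I_def[symmetric] using that by (intro *) auto
  qed (rule a)
qed

lemma AC_on_indefinite:
  assumes "a absolutely_integrable_on {s..t}"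
  shows "AC_on s t (\<lambda>x. k + integral {s..x} a) a"
  using assms by (simp add: AC_on_def)

lemma AC_on_of_real:
  assumes "\<And>x. x \<in> {s..t} \<Longrightarrow> (H has_real_derivative H' x) (at x)" "continuous_on {s..t} H'"
  shows "AC_on s t (\<lambda>x. of_real (H x)) (\<lambda>x. of_real (H' x))"
  using assms by (intro AC_on_C1 has_vector_derivative_of_real continuous_intros)
    (auto simp: has_field_derivative_at_within)

lemma AC_on_cong:
  assumes "AC_on s t A a" "\<And>x. x \<in> {s..t} \<Longrightarrow> A x = A' x" "\<And>x. x \<in> {s..t} \<Longrightarrow> a x = a' x" "s \<le> t"
  shows "AC_on s t A' a'"
  unfolding AC_on_def
proof (intro conjI ballI)
  show "a' absolutely_integrable_on {s..t}"
    by (rule absolutely_integrable_spike[OF AC_on_integrable[OF assms(1)], of "{}"]) (use assms(3) in auto)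
  show "A' x = A' s + integral {s..x} a'" if x: "x \<in> {s..t}" for x
  proof -
    have "integral {s..x} a' = integral {s..x} a"
      by (rule Henstock_Kurzweil_Integration.integral_cong) (use x assms(3) in auto)
    then show ?thesis
      using AC_on_integral[OF assms(1), of s x] assms(2)[of x] assms(2)[of s] x assms(4) by simp
  qed
qed

section \<open>The space of square integrable functions\<close>

lemma borel_measurable_cong_AE_on:
  fixes f g :: "real \<Rightarrow> complex"
  assumes f: "f \<in> borel_measurable (lebesgue_on S)" and S: "S \<in> sets lebesgue"
    and ae: "AE x in lebesgue_on S. f x = g x"
  shows "g \<in> borel_measurable (lebesgue_on S)"
proof -
  have "(\<lambda>x. if x \<in> S then f x else 0) \<in> borel_measurable lebesgue"
    using f S by (simp add: borel_measurable_if)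
  moreover have "AE x in lebesgue. (if x \<in> S then f x else 0) = (if x \<in> S then g x else 0)"
    using ae S by (simp add: AE_restrict_space_iff)
  ultimately have "(\<lambda>x. if x \<in> S then g x else 0) \<in> borel_measurable lebesgue"
    by (rule borel_measurable_AE)
  then show ?thesis using S by (simp add: borel_measurable_if)
qed

lemma borel_measurable_continuous_Ioo:
  fixes f :: "real \<Rightarrow> 'a::euclidean_space"
  shows "continuous_on {s<..<t} f \<Longrightarrow> f \<in> borel_measurable (lebesgue_on {s<..<t})"
  by (rule continuous_imp_measurable_on_sets_lebesgue) auto

lemma borel_measurable_cnj:
  "f \<in> borel_measurable M \<Longrightarrow> (\<lambda>x. cnj (f x)) \<in> borel_measurable M"
  using measurable_compose[of f M borel cnj borel] borel_measurable_continuous_onI[of cnj]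
  by (simp add: continuous_on_cnj)

lemma L2_measurable: "f \<in> L2 b \<Longrightarrow> f \<in> borel_measurable (lebesgue_on {0<..<b})"
  by (simp add: L2_def)

lemma L2_norm2_integrable: "f \<in> L2 b \<Longrightarrow> (\<lambda>x. (cmod (f x))\<^sup>2) integrable_on {0<..<b}"
  by (simp add: L2_def integrable_on_lebesgue_on)

lemma L2_I_bound:
  assumes f: "f \<in> borel_measurable (lebesgue_on {0<..<b})"
    and h: "(\<lambda>x. (h x)\<^sup>2) integrable_on {0<..<b}"
    and le: "\<And>x. 0 < x \<Longrightarrow> x < b \<Longrightarrow> cmod (f x) \<le> h x"
  shows "f \<in> L2 b"
proof -
  have "(\<lambda>x. (cmod (f x))\<^sup>2) absolutely_integrable_on {0<..<b}"
  proof (rule measurable_bounded_by_integrable_imp_absolutely_integrable[OF _ _ h])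
    show "(\<lambda>x. (cmod (f x))\<^sup>2) \<in> borel_measurable (lebesgue_on {0<..<b})"
      using f by measurable
    show "norm ((cmod (f x))\<^sup>2) \<le> (h x)\<^sup>2" if "x \<in> {0<..<b}" for x
      using le[of x] that by (simp add: power_mono)
  qed auto
  then show ?thesis using f by (simp add: L2_def absolutely_integrable_imp_integrable)
qed

lemma L2_cong_AE:
  assumes f: "f \<in> L2 b" and ae: "AE x in lebesgue_on {0<..<b}. f x = g x"
  shows "g \<in> L2 b"
proof -
  have g: "g \<in> borel_measurable (lebesgue_on {0<..<b})"
    by (rule borel_measurable_cong_AE_on[OF L2_measurable[OF f] _ ae]) auto
  have "integrable (lebesgue_on {0<..<b}) (\<lambda>x. (cmod (g x))\<^sup>2)"
    by (rule Bochner_Integration.integrable_cong_AE_imp[of _ "\<lambda>x. (cmod (f x))\<^sup>2"])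
       (use f g ae in \<open>auto simp: L2_def elim!: eventually_mono\<close>)
  then show ?thesis using g by (simp add: L2_def)
qed

lemma L2_mult_integrable:
  assumes f: "f \<in> L2 b" and g: "g \<in> L2 b"
  shows "(\<lambda>x. f x * g x) absolutely_integrable_on {0..b}"
  unfolding absolutely_integrable_on_Icc_iff_Ioo
proof (rule measurable_bounded_by_integrable_imp_absolutely_integrable)
  show "(\<lambda>x. f x * g x) \<in> borel_measurable (lebesgue_on {0<..<b})"
    using L2_measurable[OF f] L2_measurable[OF g] by measurable
  show "(\<lambda>x. (cmod (f x))\<^sup>2 + (cmod (g x))\<^sup>2) integrable_on {0<..<b}"
    by (intro integrable_add L2_norm2_integrable f g)
  show "norm (f x * g x) \<le> (cmod (f x))\<^sup>2 + (cmod (g x))\<^sup>2" for x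
  proof -
    have "2 * (cmod (f x) * cmod (g x)) \<le> (cmod (f x))\<^sup>2 + (cmod (g x))\<^sup>2"
      using sum_squares_bound[of "cmod (f x)" "cmod (g x)"] by simp
    moreover have "0 \<le> cmod (f x) * cmod (g x)" by simp
    ultimately show ?thesis unfolding norm_mult by linarith
  qed
qed auto

lemma L2_cnj: "f \<in> L2 b \<Longrightarrow> (\<lambda>x. cnj (f x)) \<in> L2 b"
  by (simp add: L2_def borel_measurable_cnj)

lemma L2_add:
  assumes f: "f \<in> L2 b" and g: "g \<in> L2 b"
  shows "(\<lambda>x. f x + g x) \<in> L2 b"
proof -
  have fg: "(\<lambda>x. f x + g x) \<in> borel_measurable (lebesgue_on {0<..<b})"
    using L2_measurable[OF f] L2_measurable[OF g] by measurable
  have int: "(\<lambda>x. 2 * (cmod (f x))\<^sup>2 + 2 * (cmod (g x))\<^sup>2) integrable_on {0<..<b}"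
    by (intro integrable_add integrable_on_mult_right L2_norm2_integrable f g)
  have le: "cmod (f x + g x) \<le> sqrt (2 * (cmod (f x))\<^sup>2 + 2 * (cmod (g x))\<^sup>2)" for x
  proof (rule real_le_rsqrt)
    have "(cmod (f x + g x))\<^sup>2 \<le> (cmod (f x) + cmod (g x))\<^sup>2"
      by (intro power_mono norm_triangle_ineq) auto
    also have "\<dots> \<le> 2 * (cmod (f x))\<^sup>2 + 2 * (cmod (g x))\<^sup>2"
      using sum_squares_bound[of "cmod (f x)" "cmod (g x)"] by (simp add: power2_sum)
    finally show "(cmod (f x + g x))\<^sup>2 \<le> 2 * (cmod (f x))\<^sup>2 + 2 * (cmod (g x))\<^sup>2" .
  qed
  show ?thesis
    by (rule L2_I_bound[OF fg _ le]) (use int in simp)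
qed

lemma L2_bounded_mult:
  assumes f: "f \<in> L2 b" and H: "H \<in> borel_measurable (lebesgue_on {0<..<b})"
    and B: "\<And>x. 0 < x \<Longrightarrow> x < b \<Longrightarrow> cmod (H x) \<le> B"
  shows "(\<lambda>x. H x * f x) \<in> L2 b"
proof (rule L2_I_bound)
  show "(\<lambda>x. H x * f x) \<in> borel_measurable (lebesgue_on {0<..<b})"
    using L2_measurable[OF f] H by measurable
  show "(\<lambda>x. (B * cmod (f x))\<^sup>2) integrable_on {0<..<b}"
    unfolding power_mult_distrib by (intro integrable_on_mult_right L2_norm2_integrable f)
  show "cmod (H x * f x) \<le> B * cmod (f x)" if "0 < x" "x < b" for x
    using B[OF that] by (simp add: norm_mult mult_right_mono)
qed

lemma L2_cmult: "f \<in> L2 b \<Longrightarrow> (\<lambda>x. c * f x) \<in> L2 b"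
  by (rule L2_bounded_mult[where B = "cmod c"]) auto

lemma L2_diff: "f \<in> L2 b \<Longrightarrow> g \<in> L2 b \<Longrightarrow> (\<lambda>x. f x - g x) \<in> L2 b"
  using L2_add[of f b "\<lambda>x. -1 * g x"] L2_cmult[of g b "-1"] by simp

lemma L2_continuous_mult:
  assumes f: "f \<in> L2 b" and H: "continuous_on {0..b} H"
  shows "(\<lambda>x. H x * f x) \<in> L2 b"
proof -
  obtain B where "\<forall>x\<in>{0..b}. cmod (H x) \<le> B"
    using compact_imp_bounded[OF compact_continuous_image[OF H compact_Icc]]
    unfolding bounded_iff by blast
  then show ?thesis
    by (intro L2_bounded_mult[OF f] borel_measurable_continuous_Ioo continuous_on_subset[OF H]) auto
qed

lemma L2_one: "(\<lambda>x. 1) \<in> L2 b"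
  by (rule L2_I_bound[where h = "\<lambda>x. 1"]) (auto intro!: integrable_on_const)

lemma L2_continuous: "continuous_on {0..b} H \<Longrightarrow> H \<in> L2 b"
  using L2_continuous_mult[OF L2_one, of b H] by simp

lemma L2_integrable: "f \<in> L2 b \<Longrightarrow> f absolutely_integrable_on {0..b}"
  using L2_mult_integrable[OF L2_one, of f b] by simp

lemma ip_eq_integral:
  assumes "(\<lambda>x. f x * cnj (g x)) absolutely_integrable_on {0..b}"
  shows "ip b f g = integral {0..b} (\<lambda>x. f x * cnj (g x))"
  using assms unfolding ip_def absolutely_integrable_on_Icc_iff_Ioo integral_open_interval_real
  by (intro lebesgue_integral_eq_integral absolutely_integrable_imp_integrable) auto

lemma ip_cong_AE:
  assumes "f \<in> borel_measurable (lebesgue_on {0<..<b})" "g \<in> borel_measurable (lebesgue_on {0<..<b})"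
    and f': "AE x in lebesgue_on {0<..<b}. f x = f' x" and g': "AE x in lebesgue_on {0<..<b}. g x = g' x"
  shows "ip b f g = ip b f' g'"
proof -
  have [measurable]: "f' \<in> borel_measurable (lebesgue_on {0<..<b})" "g' \<in> borel_measurable (lebesgue_on {0<..<b})"
    using assms by (auto intro: borel_measurable_cong_AE_on)
  have "AE x in lebesgue_on {0<..<b}. f x * cnj (g x) = f' x * cnj (g' x)"
    using f' g' by eventually_elim simp
  then show ?thesis
    unfolding ip_def using assms(1,2)
    by (intro integral_cong_AE borel_measurable_times borel_measurable_cnj) auto
qed

lemma LINT_Ioo_eq_integral:
  fixes a :: "real \<Rightarrow> complex"
  assumes "a absolutely_integrable_on {s..t}"
  shows "integral\<^sup>L (lebesgue_on {s<..<t}) a = integral {s..t} a"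
  using assms unfolding absolutely_integrable_on_Icc_iff_Ioo integral_open_interval_real
  by (intro lebesgue_integral_eq_integral absolutely_integrable_imp_integrable) auto

lemma ip_L2_integrable:
  assumes "f \<in> L2 b" "g \<in> L2 b"
  shows "integrable (lebesgue_on {0<..<b}) (\<lambda>x. f x * cnj (g x))"
  using L2_mult_integrable[OF assms(1) L2_cnj[OF assms(2)]]
  by (simp add: absolutely_integrable_on_Icc_iff_Ioo absolutely_integrable_imp_integrable)

lemma ip_diff_left: "f \<in> L2 b \<Longrightarrow> g \<in> L2 b \<Longrightarrow> h \<in> L2 b \<Longrightarrow>
    ip b (\<lambda>x. f x - g x) h = ip b f h - ip b g h"
  unfolding ip_def by (simp add: left_diff_distrib ip_L2_integrable)

lemma ip_diff_right: "f \<in> L2 b \<Longrightarrow> g \<in> L2 b \<Longrightarrow> h \<in> L2 b \<Longrightarrow>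
    ip b h (\<lambda>x. f x - g x) = ip b h f - ip b h g"
  unfolding ip_def by (simp add: right_diff_distrib ip_L2_integrable)

lemma ip_cmult_left: "ip b (\<lambda>x. c * f x) g = c * ip b f g"
  unfolding ip_def by (simp add: mult.assoc)

lemma ip_cmult_right: "ip b f (\<lambda>x. c * g x) = cnj c * ip b f g"
proof -
  have "(\<lambda>x. f x * cnj (c * g x)) = (\<lambda>x. cnj c * (f x * cnj (g x)))" by (simp add: fun_eq_iff)
  then show ?thesis unfolding ip_def by simp
qed

lemma ip_self_eq_0_imp_AE:
  assumes f: "f \<in> L2 b" and 0: "ip b f f = 0"
  shows "AE x in lebesgue_on {0<..<b}. f x = 0"
proof -
  have "ip b f f = of_real (integral\<^sup>L (lebesgue_on {0<..<b}) (\<lambda>x. (cmod (f x))\<^sup>2))"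
    unfolding ip_def complex_norm_square[symmetric] by (rule integral_complex_of_real)
  then have "integral\<^sup>L (lebesgue_on {0<..<b}) (\<lambda>x. (cmod (f x))\<^sup>2) = 0" using 0 by simp
  then have "AE x in lebesgue_on {0<..<b}. (cmod (f x))\<^sup>2 = 0"
    using f by (subst (asm) integral_nonneg_eq_0_iff_AE) (auto simp: L2_def)
  then show ?thesis by eventually_elim simp
qed

lemma L2_restrict:
  assumes f: "f \<in> L2 b"
  shows "(\<lambda>x. if e < x then f x else 0) \<in> L2 b"
proof -
  have "(\<lambda>x. indicator {e<..} x * f x) \<in> L2 b"
  proof (rule L2_bounded_mult[OF f, where B = 1])
    show "(indicator {e<..} :: real \<Rightarrow> complex) \<in> borel_measurable (lebesgue_on {0<..<b})"
      by (intro measurable_restrict_space1 borel_measurable_indicator) simp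
  qed (auto simp: indicator_def)
  then show ?thesis by (rule back_subst[of "\<lambda>f. f \<in> L2 b"]) (auto simp: fun_eq_iff)
qed

text \<open>
  The set where the two functions differ is open and null, hence empty.
\<close>

lemma continuous_AE_eq_imp_eq:
  fixes f g :: "real \<Rightarrow> complex"
  assumes f: "continuous_on {s<..<t} f" and g: "continuous_on {s<..<t} g"
    and ae: "AE x in lebesgue_on {s<..<t}. f x = g x" and x: "x \<in> {s<..<t}"
  shows "f x = g x"
proof (rule ccontr)
  assume neq: "f x \<noteq> g x"
  define N where "N = {x \<in> {s<..<t}. f x - g x \<in> - {0}}"
  have op: "open N"
  proof -
    have "open ({s<..<t} \<inter> (\<lambda>x. f x - g x) -` (- {0}))"
      by (intro continuous_open_preimage continuous_intros f g)
    then show ?thesis by (simp add: N_def vimage_def Int_def)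
  qed
  have "AE x in lebesgue. x \<notin> N"
    using ae by (auto simp: AE_restrict_space_iff N_def elim!: eventually_mono)
  then have "N \<in> null_sets lebesgue"
    using op by (subst AE_iff_null_sets) auto
  then have "negligible N" by (simp add: negligible_iff_null_sets)
  moreover have "N \<noteq> {}" using neq x by (auto simp: N_def)
  ultimately show False using open_not_negligible[OF op] by simp
qed

lemma integral_of_real_complex:
  assumes "(\<lambda>x. complex_of_real (f x)) integrable_on S"
  shows "f integrable_on S" "integral S (\<lambda>x. complex_of_real (f x)) = of_real (integral S f)"
proof -
  show f: "f integrable_on S"
    using integrable_linear[OF assms bounded_linear_Re] by (simp add: o_def)
  show "integral S (\<lambda>x. complex_of_real (f x)) = of_real (integral S f)"
    using integral_linear[OF f, of complex_of_real] by (simp add: o_def bounded_linear_of_real)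
qed

lemma two_of_real_mult_Re: "2 * complex_of_real (s * Re z) = of_real s * (z + cnj z)"
  by (simp add: complex_eq_iff)

section \<open>The solutions of the homogeneous equation\<close>

text \<open>
  The equation is \<open>y'' = pot \<nu> * y\<close>. Its solution \<open>reg\<close> is the smaller one at \<open>0\<close>; the factor
  \<open>1/(2\<nu>)\<close> and the sign in \<open>sing\<close> make the Wronskian \<open>1\<close> for every \<open>\<nu>\<close>, and this is what
  lets the case \<open>\<nu> = 0\<close> share all later arguments.
\<close>

definition pot :: "real \<Rightarrow> real \<Rightarrow> real" where
  "pot \<nu> x = (\<nu>\<^sup>2 - 1/4) / x\<^sup>2"

definition reg :: "real \<Rightarrow> real \<Rightarrow> real" where
  "reg \<nu> x = x powr (1/2 + \<nu>)"

definition reg' :: "real \<Rightarrow> real \<Rightarrow> real" where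
  "reg' \<nu> x = (1/2 + \<nu>) * x powr (\<nu> - 1/2)"

definition sing :: "real \<Rightarrow> real \<Rightarrow> real" where
  "sing \<nu> x = (if \<nu> = 0 then - (x powr (1/2) * ln x) else x powr (1/2 - \<nu>) / (2 * \<nu>))"

definition sing' :: "real \<Rightarrow> real \<Rightarrow> real" where
  "sing' \<nu> x = (if \<nu> = 0 then - (x powr (-1/2) * (ln x / 2 + 1))
                else (1/2 - \<nu>) * x powr (- 1/2 - \<nu>) / (2 * \<nu>))"

lemma reg_deriv: "0 < x \<Longrightarrow> (reg \<nu> has_real_derivative reg' \<nu> x) (at x)"
  unfolding reg_def[abs_def] reg'_def by (auto intro!: derivative_eq_intros simp: field_simps)

lemma powr_shift: "0 < x \<Longrightarrow> x powr (a - 2) = x powr a / x\<^sup>2" for x a :: real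
  by (simp add: powr_diff)

lemma reg'_deriv:
  assumes "0 < x"
  shows "(reg' \<nu> has_real_derivative pot \<nu> x * reg \<nu> x) (at x)"
proof -
  have "(reg' \<nu> has_real_derivative (1/2 + \<nu>) * ((\<nu> - 1/2) * x powr (\<nu> - 1/2 - 1))) (at x)"
    unfolding reg'_def[abs_def] by (intro DERIV_cmult has_real_derivative_powr assms)
  moreover have "x powr (\<nu> - 1/2 - 1) = x powr (1/2 + \<nu>) / x\<^sup>2"
    using powr_shift[OF assms, of "1/2 + \<nu>"] by (simp add: algebra_simps)
  ultimately have "(reg' \<nu> has_real_derivative (1/2 + \<nu>) * ((\<nu> - 1/2) * (x powr (1/2 + \<nu>) / x\<^sup>2))) (at x)"
    by (simp only:)
  also have "(1/2 + \<nu>) * ((\<nu> - 1/2) * (x powr (1/2 + \<nu>) / x\<^sup>2)) = pot \<nu> x * reg \<nu> x"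
    using assms by (simp add: reg_def pot_def power2_eq_square field_simps)
  finally show ?thesis .
qed

lemma sing_deriv: "0 < x \<Longrightarrow> (sing \<nu> has_real_derivative sing' \<nu> x) (at x)"
  using powr_diff[of x "1/2" 1]
  unfolding sing_def[abs_def] sing'_def
  by (auto intro!: derivative_eq_intros simp: field_simps)

lemma sing'_deriv:
  assumes "0 < x"
  shows "(sing' \<nu> has_real_derivative pot \<nu> x * sing \<nu> x) (at x)"
proof (cases "\<nu> = 0")
  case True
  define z where "z = x powr (-3/2)"
  have z: "x powr (-1/2) = x * z" "x powr (1/2) = x\<^sup>2 * z"
    using assms powr_add[of x 1 "-3/2"] powr_add[of x 2 "-3/2"] by (simp_all add: z_def)
  have "((\<lambda>x. - (x powr (-1/2) * (ln x / 2 + 1))) has_real_derivative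
      - ((-1/2 * x powr (-1/2 - 1)) * (ln x / 2 + 1) + (1 / x / 2) * x powr (-1/2))) (at x)"
    using assms by (intro DERIV_minus DERIV_mult has_real_derivative_powr) (auto intro!: derivative_eq_intros)
  also have "- ((-1/2 * x powr (-1/2 - 1)) * (ln x / 2 + 1) + (1 / x / 2) * x powr (-1/2)) = z * ln x / 4"
  proof -
    have "x powr (-1/2 - 1) = z" by (simp add: z_def)
    then show ?thesis using assms unfolding z by (simp add: field_simps)
  qed
  also have "z * ln x / 4 = pot \<nu> x * sing \<nu> x"
    using True assms z by (simp add: pot_def sing_def)
  finally show ?thesis
    using True by (simp add: sing'_def[abs_def])
next
  case False
  have "((\<lambda>x. (1/2 - \<nu>) * x powr (- 1/2 - \<nu>) / (2 * \<nu>)) has_real_derivative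
      (1/2 - \<nu>) * ((- 1/2 - \<nu>) * x powr (- 1/2 - \<nu> - 1)) / (2 * \<nu>)) (at x)"
    by (intro DERIV_cdivide DERIV_cmult has_real_derivative_powr assms)
  moreover have "x powr (- 1/2 - \<nu> - 1) = x powr (1/2 - \<nu>) / x\<^sup>2"
    using powr_shift[OF assms, of "1/2 - \<nu>"] by (simp add: algebra_simps)
  ultimately have "((\<lambda>x. (1/2 - \<nu>) * x powr (- 1/2 - \<nu>) / (2 * \<nu>)) has_real_derivative
      (1/2 - \<nu>) * ((- 1/2 - \<nu>) * (x powr (1/2 - \<nu>) / x\<^sup>2)) / (2 * \<nu>)) (at x)"
    by (simp only:)
  also have "(1/2 - \<nu>) * ((- 1/2 - \<nu>) * (x powr (1/2 - \<nu>) / x\<^sup>2)) / (2 * \<nu>) = pot \<nu> x * sing \<nu> x"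
    using assms False by (simp add: sing_def pot_def power2_eq_square field_simps)
  finally show ?thesis
    using False by (simp add: sing'_def[abs_def])
qed

lemma wronskian: "0 < x \<Longrightarrow> sing \<nu> x * reg' \<nu> x - sing' \<nu> x * reg \<nu> x = 1"
  unfolding reg_def reg'_def sing_def sing'_def
  by (auto simp: field_simps powr_add[symmetric])

lemma reg_pos: "0 < x \<Longrightarrow> 0 < reg \<nu> x"
  by (simp add: reg_def)

lemma sing_over_reg:
  "0 < x \<Longrightarrow> sing \<nu> x / reg \<nu> x = (if \<nu> = 0 then - ln x else x powr (- 2 * \<nu>) / (2 * \<nu>))"
  unfolding reg_def sing_def
  by (auto simp: field_simps powr_add[symmetric])

text \<open>
  The derivative of \<open>sing / reg\<close> is \<open>-1 / reg\<^sup>2\<close>, by the Wronskian. The ratio is also explicit, which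
  gives a direct proof.
\<close>

lemma sing_over_reg_decreasing:
  assumes "0 \<le> \<nu>" "0 < x" "x < y"
  shows "sing \<nu> y / reg \<nu> y < sing \<nu> x / reg \<nu> x"
  using assms by (auto simp: sing_over_reg divide_strict_right_mono powr_less_mono2_neg)

lemma sing_over_reg_unbounded:
  assumes "0 \<le> \<nu>"
  obtains d where "0 < d" "\<And>x. 0 < x \<Longrightarrow> x < d \<Longrightarrow> K < sing \<nu> x / reg \<nu> x"
proof -
  have "\<exists>d>0. K \<le> sing \<nu> d / reg \<nu> d"
  proof (cases "\<nu> = 0")
    case True
    then show ?thesis by (intro exI[of _ "exp (- K)"]) (simp add: sing_over_reg)
  next
    case False
    define L where "L = 2 * \<nu> * (\<bar>K\<bar> + 1)"
    have "0 < L" using False assms by (simp add: L_def)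
    then have "sing \<nu> (L powr (-1 / (2 * \<nu>))) / reg \<nu> (L powr (-1 / (2 * \<nu>))) = \<bar>K\<bar> + 1"
      using False by (simp add: sing_over_reg powr_powr) (simp add: L_def)
    then show ?thesis using \<open>0 < L\<close> by (intro exI[of _ "L powr (-1 / (2 * \<nu>))"]) auto
  qed
  then obtain d where "0 < d" "K \<le> sing \<nu> d / reg \<nu> d" by blast
  then show ?thesis
    using sing_over_reg_decreasing[OF assms, of _ d] that[of d] by (meson le_less_trans)
qed

text \<open>
  A single power bound for both solutions, with \<open>\<mu> = \<nu>\<close>, or \<open>\<mu> = 1/2\<close> to absorb the logarithm if \<open>\<nu> = 0\<close>.
  The point is \<open>\<mu> < 1\<close>: the solutions are then square integrable, which is the limit circle case at \<open>0\<close>.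
\<close>

lemma solution_growth:
  assumes "0 \<le> \<nu>" "\<nu> < 1" "0 < b"
  obtains C \<mu> where "\<mu> < 1" "0 \<le> C"
    "\<And>x. 0 < x \<Longrightarrow> x \<le> b \<Longrightarrow> \<bar>reg \<nu> x\<bar> \<le> C * x powr (1/2 - \<mu>)"
    "\<And>x. 0 < x \<Longrightarrow> x \<le> b \<Longrightarrow> \<bar>sing \<nu> x\<bar> \<le> C * x powr (1/2 - \<mu>)"
    "\<And>x. 0 < x \<Longrightarrow> x \<le> b \<Longrightarrow> \<bar>reg' \<nu> x\<bar> \<le> C * x powr (- 1/2 - \<mu>)"
    "\<And>x. 0 < x \<Longrightarrow> x \<le> b \<Longrightarrow> \<bar>sing' \<nu> x\<bar> \<le> C * x powr (- 1/2 - \<mu>)"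
proof (cases "\<nu> = 0")
  case False
  with assms have "0 < \<nu>" by simp
  define C where "C = 2 * b powr (2 * \<nu>) + 1 / (2 * \<nu>)"
  have "\<bar>reg \<nu> x\<bar> \<le> C * x powr (1/2 - \<nu>) \<and> \<bar>sing \<nu> x\<bar> \<le> C * x powr (1/2 - \<nu>) \<and>
    \<bar>reg' \<nu> x\<bar> \<le> C * x powr (- 1/2 - \<nu>) \<and> \<bar>sing' \<nu> x\<bar> \<le> C * x powr (- 1/2 - \<nu>)"
    if x: "0 < x" "x \<le> b" for x
  proof -
    have xb: "x powr (2 * \<nu>) \<le> b powr (2 * \<nu>)"
      using x \<open>0 < \<nu>\<close> by (intro powr_mono2) auto
    have e1: "reg \<nu> x = x powr (2 * \<nu>) * x powr (1/2 - \<nu>)"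
      and e2: "reg' \<nu> x = (1/2 + \<nu>) * x powr (2 * \<nu>) * x powr (- 1/2 - \<nu>)"
      using x by (simp_all add: reg_def reg'_def powr_add[symmetric] add.commute)
    have e3: "sing \<nu> x = 1 / (2 * \<nu>) * x powr (1/2 - \<nu>)"
      and e4: "sing' \<nu> x = (1/2 - \<nu>) / (2 * \<nu>) * x powr (- 1/2 - \<nu>)"
      using False by (simp_all add: sing_def sing'_def)
    have "(1/2 + \<nu>) * x powr (2 * \<nu>) \<le> 2 * b powr (2 * \<nu>)"
      using xb assms by (intro mult_mono) auto
    moreover have "\<bar>(1/2 - \<nu>) / (2 * \<nu>)\<bar> \<le> 1 / (2 * \<nu>)"
      using assms \<open>0 < \<nu>\<close> by (auto simp: abs_divide intro!: divide_right_mono)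
    moreover have "0 < 1 / (2 * \<nu>)" "0 < b powr (2 * \<nu>)" using \<open>0 < \<nu>\<close> assms by auto
    moreover have "0 \<le> x powr (2 * \<nu>)" "0 \<le> (1/2 + \<nu>) * x powr (2 * \<nu>)"
      using \<open>0 < \<nu>\<close> by auto
    ultimately have "\<bar>x powr (2 * \<nu>)\<bar> \<le> C" "\<bar>(1/2 + \<nu>) * x powr (2 * \<nu>)\<bar> \<le> C"
      "\<bar>1 / (2 * \<nu>)\<bar> \<le> C" "\<bar>(1/2 - \<nu>) / (2 * \<nu>)\<bar> \<le> C"
      using xb unfolding C_def by linarith+
    moreover have "\<bar>e * x powr p\<bar> \<le> C * x powr p" if "\<bar>e\<bar> \<le> C" for e p
      using that by (simp add: abs_mult mult_right_mono)
    ultimately show ?thesis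
      unfolding e1 e2 e3 e4 by blast
  qed
  moreover have "0 \<le> C" using \<open>0 < \<nu>\<close> by (simp add: C_def)
  ultimately show ?thesis using that[of \<nu> C] assms by blast
next
  case True
  define C where "C = 2 + 2 * b powr (1/2) + b powr (3/2)"
  have C0: "0 \<le> C" by (simp add: C_def)
  have "\<bar>reg \<nu> x\<bar> \<le> C * x powr (1/2 - 1/2) \<and> \<bar>sing \<nu> x\<bar> \<le> C * x powr (1/2 - 1/2) \<and>
    \<bar>reg' \<nu> x\<bar> \<le> C * x powr (- 1/2 - 1/2) \<and> \<bar>sing' \<nu> x\<bar> \<le> C * x powr (- 1/2 - 1/2)"
    if x: "0 < x" "x \<le> b" for x
  proof -
    have b1: "x powr (1/2) \<le> b powr (1/2)" and b2: "x powr (3/2) \<le> b powr (3/2)"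
      using x by (auto intro!: powr_mono2)
    have "x powr (1/2) * ln x \<le> x powr (1/2) * x"
      using x ln_bound[of x] by (intro mult_left_mono) auto
    also have "\<dots> = x powr (3/2)" using x powr_add[of x "1/2" 1] by simp
    finally have up: "x powr (1/2) * ln x \<le> x powr (3/2)" .
    have "- (ln x / 2) < x powr (-1/2)"
      using ln_less_self[of "x powr (-1/2)"] x by (simp add: ln_powr)
    then have "x powr (1/2) * (- (ln x / 2)) \<le> x powr (1/2) * x powr (-1/2)"
      by (intro mult_left_mono) auto
    also have "\<dots> = 1" using x by (simp add: powr_add[symmetric])
    finally have "- (x powr (1/2) * ln x) \<le> 2" by simp
    then have "\<bar>x powr (1/2) * ln x\<bar> \<le> 2 + x powr (3/2)"
      using up powr_ge_zero[of x "3/2"] by (simp only: abs_le_iff) linarith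
    then have l: "\<bar>x powr (1/2) * ln x\<bar> \<le> 2 + b powr (3/2)" using b2 by linarith
    have e: "x powr (-1/2) = x powr (1/2) * x powr (-1)"
      using x powr_add[of x "1/2" "-1"] by simp
    have "\<bar>x powr (1/2) * (ln x / 2 + 1)\<bar> \<le> \<bar>x powr (1/2) * ln x\<bar> / 2 + x powr (1/2)"
      using abs_triangle_ineq[of "x powr (1/2) * ln x / 2" "x powr (1/2)"] by (simp add: algebra_simps)
    then have "\<bar>x powr (1/2) * (ln x / 2 + 1)\<bar> \<le> C"
      using l b1 abs_ge_zero[of "x powr (1/2) * ln x"] unfolding C_def by linarith
    then have "\<bar>x powr (1/2) * (ln x / 2 + 1)\<bar> * x powr (-1) \<le> C * x powr (-1)"
      by (intro mult_right_mono) auto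
    moreover have "sing' \<nu> x = - (x powr (1/2) * (ln x / 2 + 1) * x powr (-1))"
      unfolding sing'_def e using True by (simp only: if_True mult_ac simp_thms)
    ultimately have s': "\<bar>sing' \<nu> x\<bar> \<le> C * x powr (-1)"
      by (simp only: abs_minus_cancel abs_mult abs_of_nonneg[OF powr_ge_zero])
    have nn: "0 \<le> b powr (1/2)" "0 \<le> b powr (3/2)" "0 \<le> x powr (1/2)" by simp_all
    have "\<bar>x powr (1/2) * ln x\<bar> \<le> C" "x powr (1/2) \<le> C"
      using l b1 nn unfolding C_def by linarith+
    then have "\<bar>sing \<nu> x\<bar> \<le> C" "\<bar>reg \<nu> x\<bar> \<le> C"
      using True by (simp_all add: sing_def reg_def)
    moreover have "\<bar>reg' \<nu> x\<bar> \<le> C * x powr (-1)"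
    proof -
      have "1/2 * x powr (1/2) \<le> C"
        using b1 nn unfolding C_def by linarith
      then have "1/2 * x powr (1/2) * x powr (-1) \<le> C * x powr (-1)"
        by (intro mult_right_mono) auto
      then show ?thesis using True e by (simp add: reg'_def)
    qed
    ultimately show ?thesis using s' x by simp
  qed
  then show ?thesis using that[of "1/2" C] C0 by auto
qed

section \<open>Functions in H2 that vanish at 0 with their derivative\<close>

lemma H2_fun_AC:
  assumes "H2_fun b \<phi> \<phi>1 \<phi>2"
  shows "AC_on 0 b \<phi> \<phi>1" "AC_on 0 b \<phi>1 \<phi>2" "\<phi>2 \<in> L2 b"
proof -
  show \<phi>2: "\<phi>2 \<in> L2 b" using assms unfolding H2_fun_def by blast
  have int: "\<phi>2 absolutely_integrable_on {0..b}" by (rule L2_integrable[OF \<phi>2])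
  show AC: "AC_on 0 b \<phi>1 \<phi>2"
    unfolding AC_on_def
  proof (intro conjI ballI)
    show "\<phi>1 x = \<phi>1 0 + integral {0..x} \<phi>2" if x: "x \<in> {0..b}" for x
    proof -
      have "integral\<^sup>L (lebesgue_on {0<..<x}) \<phi>2 = integral {0..x} \<phi>2"
        by (rule LINT_Ioo_eq_integral, rule absolutely_integrable_on_subinterval[OF int]) (use x in auto)
      moreover have "\<phi>1 x = \<phi>1 0 + integral\<^sup>L (lebesgue_on {0<..<x}) \<phi>2"
        using assms x unfolding H2_fun_def by blast
      ultimately show ?thesis by simp
    qed
  qed (rule int)
  show "AC_on 0 b \<phi> \<phi>1"
    using assms unfolding H2_fun_def by (intro AC_on_C1 AC_on_continuous[OF AC]) blast
qed

text \<open>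
  The power gained at \<open>0\<close> compensates the singularity of the potential. The first bound is the
  Cauchy-Schwarz inequality on \<open>[0,x]\<close>; it is obtained by integrating
  \<open>|y| \<le> 1/(2s) + (s/2) |y|\<^sup>2\<close> with \<open>s = x\<^bsup>1/2\<^esup>\<close>. The second one follows by integrating the first.
\<close>

lemma H2_fun_growth:
  assumes H2: "H2_fun b \<phi> \<phi>1 \<phi>2" and "\<phi> 0 = 0" "\<phi>1 0 = 0"
  obtains K where "0 \<le> K" "\<And>x. 0 < x \<Longrightarrow> x \<le> b \<Longrightarrow> cmod (\<phi>1 x) \<le> K * x powr (1/2)"
    "\<And>x. 0 < x \<Longrightarrow> x \<le> b \<Longrightarrow> cmod (\<phi> x) \<le> K * x powr (3/2)"
proof -
  note AC = H2_fun_AC[OF H2]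
  define N where "N = integral {0..b} (\<lambda>t. (cmod (\<phi>2 t))\<^sup>2)"
  define K where "K = (1 + N) / 2"
  have sq: "(\<lambda>t. (cmod (\<phi>2 t))\<^sup>2) integrable_on {0..b}"
    using L2_norm2_integrable[OF AC(3)] by (simp add: integrable_on_Icc_iff_Ioo)
  then have N0: "0 \<le> N"
    unfolding N_def by (rule Henstock_Kurzweil_Integration.integral_nonneg) simp
  have b1: "cmod (\<phi>1 x) \<le> K * x powr (1/2)" if x: "0 < x" "x \<le> b" for x
  proof -
    define s where "s = x powr (1/2)"
    have s: "0 < s" "s * s = x" using x by (simp_all add: s_def powr_add[symmetric])
    have sqx: "(\<lambda>t. (cmod (\<phi>2 t))\<^sup>2) integrable_on {0..x}"
      by (rule integrable_on_subinterval[OF sq]) (use x in auto)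
    have "cmod (integral {0..x} \<phi>2) \<le> integral {0..x} (\<lambda>t. 1 / (2 * s) + s / 2 * (cmod (\<phi>2 t))\<^sup>2)"
    proof (rule integral_norm_bound_integral)
      show "\<phi>2 integrable_on {0..x}"
        by (rule integrable_on_subinterval[OF set_lebesgue_integral_eq_integral(1)[OF AC_on_integrable[OF AC(2)]]])
           (use x in auto)
      show "(\<lambda>t. 1 / (2 * s) + s / 2 * (cmod (\<phi>2 t))\<^sup>2) integrable_on {0..x}"
        by (intro integrable_add integrable_on_mult_right sqx) auto
      show "cmod (\<phi>2 t) \<le> 1 / (2 * s) + s / 2 * (cmod (\<phi>2 t))\<^sup>2" for t
      proof -
        have "0 \<le> (s * cmod (\<phi>2 t) - 1)\<^sup>2 / (2 * s)" using s by simp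
        also have "\<dots> = 1 / (2 * s) + s / 2 * (cmod (\<phi>2 t))\<^sup>2 - cmod (\<phi>2 t)"
          using s by (simp add: power2_eq_square field_simps)
        finally show ?thesis by simp
      qed
    qed
    also have "\<dots> = x / (2 * s) + s / 2 * integral {0..x} (\<lambda>t. (cmod (\<phi>2 t))\<^sup>2)"
      using x sqx by (subst Henstock_Kurzweil_Integration.integral_add) (auto intro: integrable_on_mult_right)
    also have "x / (2 * s) = s / 2" using s by (simp add: field_simps)
    also have "s / 2 + s / 2 * integral {0..x} (\<lambda>t. (cmod (\<phi>2 t))\<^sup>2) \<le> s / 2 + s / 2 * N"
      unfolding N_def using x s sq sqx by (intro add_mono mult_left_mono integral_subset_le) auto
    also have "\<dots> = K * s" by (simp add: K_def field_simps)
    finally show ?thesis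
      using AC_on_integral[OF AC(2), of 0 x] x assms(3) by (simp add: s_def)
  qed
  have "cmod (\<phi> x) \<le> K * x powr (3/2)" if x: "0 < x" "x \<le> b" for x
  proof -
    have "cmod (integral {0..x} \<phi>1) \<le> integral {0..x} (\<lambda>t. K * x powr (1/2))"
    proof (rule integral_norm_bound_integral)
      show "\<phi>1 integrable_on {0..x}"
        by (rule integrable_on_subinterval[OF set_lebesgue_integral_eq_integral(1)[OF AC_on_integrable[OF AC(1)]]])
           (use x in auto)
      show "cmod (\<phi>1 t) \<le> K * x powr (1/2)" if t: "t \<in> {0..x}" for t
      proof (cases "t = 0")
        case True then show ?thesis using assms(3) N0 by (simp add: K_def)
      next
        case False
        then have "cmod (\<phi>1 t) \<le> K * t powr (1/2)" using b1[of t] t x by simp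
        also have "\<dots> \<le> K * x powr (1/2)"
          using t N0 by (intro mult_left_mono powr_mono2) (auto simp: K_def)
        finally show ?thesis .
      qed
    qed auto
    also have "\<dots> = K * (x * x powr (1/2))" using x by simp
    also have "x * x powr (1/2) = x powr (3/2)" using x powr_add[of x 1 "1/2"] by simp
    finally show ?thesis
      using AC_on_integral[OF AC(1), of 0 x] x assms(2) by simp
  qed
  then show ?thesis using b1 N0 by (intro that[of K]) (auto simp: K_def)
qed

lemma tendsto_at_right_0I:
  fixes A :: "real \<Rightarrow> complex"
  assumes "0 < b" "0 < e" "\<And>x. 0 < x \<Longrightarrow> x \<le> b \<Longrightarrow> cmod (A x) \<le> D * x powr e"
  shows "(A \<longlongrightarrow> 0) (at_right 0)"
proof (rule Lim_null_comparison)
  show "\<forall>\<^sub>F x in at_right 0. cmod (A x) \<le> D * x powr e"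
    using eventually_at_right_real[OF assms(1)] by eventually_elim (use assms(3) in auto)
  have "((\<lambda>x. x powr e) \<longlongrightarrow> 0 powr e) (at_right 0)"
    using assms(2) by (intro tendsto_powr2 tendsto_ident_at tendsto_const) (auto simp: eventually_at_right_less intro: eventually_mono[OF eventually_at_right_less])
  then show "((\<lambda>x. D * x powr e) \<longlongrightarrow> 0) (at_right 0)"
    by (auto intro: tendsto_mult_right_zero)
qed

section \<open>Variation of parameters\<close>

locale bessel_interval =
  fixes \<nu> b :: real
  assumes nu: "0 \<le> \<nu>" "\<nu> < 1" and b: "0 < b"
begin

abbreviation "F \<equiv> reg \<nu>"
abbreviation "F' \<equiv> reg' \<nu>"
abbreviation "G \<equiv> sing \<nu>"
abbreviation "G' \<equiv> sing' \<nu>"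
abbreviation "q \<equiv> pot \<nu>"

lemma continuous_on_pot: "0 < s \<Longrightarrow> continuous_on {s..t} q"
  unfolding pot_def by (intro continuous_intros) auto

lemma continuous_on_solutions:
  assumes "0 < s"
  shows "continuous_on {s..t} F" "continuous_on {s..t} F'" "continuous_on {s..t} G" "continuous_on {s..t} G'"
proof -
  have *: "continuous_on {s..t} H" if "\<And>x. 0 < x \<Longrightarrow> (H has_real_derivative D x) (at x)" for H D
    using that assms by (intro DERIV_continuous_on[of _ _ D]) (auto simp: has_field_derivative_at_within)
  show "continuous_on {s..t} F" by (rule *[OF reg_deriv])
  show "continuous_on {s..t} F'" by (rule *[OF reg'_deriv])
  show "continuous_on {s..t} G" by (rule *[OF sing_deriv])
  show "continuous_on {s..t} G'" by (rule *[OF sing'_deriv])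
qed

lemma AC_on_solutions:
  assumes "0 < s"
  shows "AC_on s t (\<lambda>x. of_real (F x)) (\<lambda>x. of_real (F' x))"
    "AC_on s t (\<lambda>x. of_real (G x)) (\<lambda>x. of_real (G' x))"
    "AC_on s t (\<lambda>x. of_real (F' x)) (\<lambda>x. of_real (q x * F x))"
    "AC_on s t (\<lambda>x. of_real (G' x)) (\<lambda>x. of_real (q x * G x))"
  using assms
  by (auto simp del: of_real_mult intro!: AC_on_of_real reg_deriv reg'_deriv sing_deriv sing'_deriv continuous_on_solutions
      continuous_on_mult continuous_on_pot)

lemma solutions_L2: "(\<lambda>x. of_real (F x)) \<in> L2 b" "(\<lambda>x. of_real (G x)) \<in> L2 b"
proof -
  obtain C \<mu> where C: "\<mu> < 1" "0 \<le> C"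
    "\<And>x. 0 < x \<Longrightarrow> x \<le> b \<Longrightarrow> \<bar>F x\<bar> \<le> C * x powr (1/2 - \<mu>)"
    "\<And>x. 0 < x \<Longrightarrow> x \<le> b \<Longrightarrow> \<bar>G x\<bar> \<le> C * x powr (1/2 - \<mu>)"
    using solution_growth[OF nu b] by metis
  have "(\<lambda>x. C\<^sup>2 * x powr (1 - 2 * \<mu>)) integrable_on {0..b}"
    using C b by (intro integrable_on_mult_right integrable_on_powr_from_0) auto
  then have "(\<lambda>x. (C * x powr (1/2 - \<mu>))\<^sup>2) integrable_on {0..b}"
    by (rule integrable_eq) (auto simp: power_mult_distrib power2_eq_square[of "_ powr _"] powr_add[symmetric])
  then have int: "(\<lambda>x. (C * x powr (1/2 - \<mu>))\<^sup>2) integrable_on {0<..<b}"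
    by (simp add: integrable_on_Icc_iff_Ioo)
  have cont: "continuous_on {0<..<b} H" if "\<And>x. 0 < x \<Longrightarrow> (H has_real_derivative D x) (at x)" for H D
    using that by (intro DERIV_continuous_on[of _ _ D]) (auto simp: has_field_derivative_at_within)
  show "(\<lambda>x. of_real (F x)) \<in> L2 b" "(\<lambda>x. of_real (G x)) \<in> L2 b"
    by (rule L2_I_bound[OF _ int]; use C in \<open>auto intro!: borel_measurable_continuous_Ioo
      continuous_on_of_real cont[OF reg_deriv] cont[OF sing_deriv]\<close>)+
qed

text \<open>
  The condition under which the coefficients in the variation of parameters extend to \<open>0\<close>.
  Stating the lemmas for it makes them apply to the values of the minimal operator without first
  proving by Hardy's inequality that those are square integrable.
\<close>

definition admissible :: "(real \<Rightarrow> complex) \<Rightarrow> bool" where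
  "admissible g \<longleftrightarrow> (\<lambda>x. of_real (F x) * g x) absolutely_integrable_on {0..b} \<and>
                   (\<lambda>x. of_real (G x) * g x) absolutely_integrable_on {0..b}"

lemma admissible_L2: "g \<in> L2 b \<Longrightarrow> admissible g"
  unfolding admissible_def by (intro conjI L2_mult_integrable solutions_L2)

text \<open>
  \<open>sol a c g\<close> is the solution of \<open>-y'' + q y = g\<close> whose coefficients with respect to \<open>F\<close> and \<open>G\<close>
  tend to \<open>a\<close> and \<open>c\<close> at \<open>0\<close>; \<open>sol'\<close> is its derivative. In particular \<open>sol 0 0 g\<close> is the solution with
  vanishing data at \<open>0\<close>, which is the form taken by elements of the domain of the minimal operator.
\<close>

definition coef_F where "coef_F a g x = a + integral {0..x} (\<lambda>t. - (of_real (G t) * g t))"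
  for a :: complex and g
definition coef_G where "coef_G c g x = c + integral {0..x} (\<lambda>t. of_real (F t) * g t)"
  for c :: complex and g

definition sol where "sol a c g x = of_real (F x) * coef_F a g x + of_real (G x) * coef_G c g x"
definition sol' where "sol' a c g x = of_real (F' x) * coef_F a g x + of_real (G' x) * coef_G c g x"

lemma AC_on_coeffs:
  assumes "admissible g"
  shows "AC_on 0 b (coef_F a g) (\<lambda>x. - (of_real (G x) * g x))"
    and "AC_on 0 b (coef_G c g) (\<lambda>x. of_real (F x) * g x)"
proof -
  have "(\<lambda>x. - (of_real (G x) * g x)) absolutely_integrable_on {0..b}"
    using absolutely_integrable_mult_continuous(1)[of 0 b "\<lambda>x. -1" "\<lambda>x. of_real (G x) * g x"] assms
    by (simp add: admissible_def)
  then show "AC_on 0 b (coef_F a g) (\<lambda>x. - (of_real (G x) * g x))"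
    unfolding coef_F_def[abs_def] by (rule AC_on_indefinite)
  show "AC_on 0 b (coef_G c g) (\<lambda>x. of_real (F x) * g x)"
    using assms unfolding coef_G_def[abs_def] admissible_def by (intro AC_on_indefinite) auto
qed

lemma coeffs_0 [simp]: "coef_F a g 0 = a" "coef_G c g 0 = c"
  by (simp_all add: coef_F_def coef_G_def)

lemma wronskian_complex:
  "0 < x \<Longrightarrow> complex_of_real (G x) * of_real (F' x) - of_real (G' x) * of_real (F x) = 1"
  using wronskian[of x \<nu>] by (metis of_real_1 of_real_diff of_real_mult)

text \<open>
  The terms containing \<open>g\<close> cancel in the first derivative, and the Wronskian makes their sum \<open>-g\<close>
  in the second.
\<close>

lemma AC_on_sol:
  assumes g: "admissible g" and s: "0 < s" "s \<le> b"
  shows "AC_on s b (sol a c g) (sol' a c g)"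
    and "AC_on s b (sol' a c g) (\<lambda>x. of_real (q x) * sol a c g x - g x)"
proof -
  note coeffs = AC_on_coeffs(1)[OF g, of a, THEN AC_on_subinterval, of s b]
    AC_on_coeffs(2)[OF g, of c, THEN AC_on_subinterval, of s b]
  note prods = AC_on_solutions[OF s(1), of b, THEN AC_on_mult]
  have "AC_on s b (\<lambda>x. of_real (F x) * coef_F a g x + of_real (G x) * coef_G c g x)
     (\<lambda>x. (of_real (F' x) * coef_F a g x + of_real (F x) * - (of_real (G x) * g x))
       + (of_real (G' x) * coef_G c g x + of_real (G x) * (of_real (F x) * g x)))"
    using s by (intro AC_on_add prods coeffs) auto
  then show "AC_on s b (sol a c g) (sol' a c g)"
    by (rule AC_on_cong) (use s in \<open>simp_all add: sol_def sol'_def\<close>)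
  have "AC_on s b (\<lambda>x. of_real (F' x) * coef_F a g x + of_real (G' x) * coef_G c g x)
     (\<lambda>x. (of_real (q x * F x) * coef_F a g x + of_real (F' x) * - (of_real (G x) * g x))
       + (of_real (q x * G x) * coef_G c g x + of_real (G' x) * (of_real (F x) * g x)))"
    using s by (intro AC_on_add prods coeffs) auto
  then show "AC_on s b (sol' a c g) (\<lambda>x. of_real (q x) * sol a c g x - g x)"
  proof (rule AC_on_cong)
    fix x assume "x \<in> {s..b}"
    then have W: "complex_of_real (G x) * of_real (F' x) = 1 + of_real (G' x) * of_real (F x)"
      using wronskian_complex[of x] s by (simp add: algebra_simps)
    have "(of_real (q x * F x) * coef_F a g x + of_real (F' x) * - (of_real (G x) * g x))
       + (of_real (q x * G x) * coef_G c g x + of_real (G' x) * (of_real (F x) * g x))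
      = of_real (q x) * sol a c g x - (complex_of_real (G x) * of_real (F' x)) * g x
         + of_real (G' x) * of_real (F x) * g x"
      by (simp add: sol_def algebra_simps)
    then show "(of_real (q x * F x) * coef_F a g x + of_real (F' x) * - (of_real (G x) * g x))
       + (of_real (q x * G x) * coef_G c g x + of_real (G' x) * (of_real (F x) * g x))
      = of_real (q x) * sol a c g x - g x"
      unfolding W by (simp add: algebra_simps)
  qed (use s in \<open>simp_all add: sol'_def\<close>)
qed

lemma sol_deriv:
  assumes g: "admissible g" and x: "0 < x" "x < b"
  shows "(sol a c g has_vector_derivative sol' a c g x) (at x)"
proof -
  have "(sol a c g has_vector_derivative sol' a c g x) (at x within {x/2..b})"
    by (intro AC_on_has_vector_derivative AC_on_sol[OF g] AC_on_continuous[OF AC_on_sol(2)[OF g]]) (use x in auto)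
  then show ?thesis
    using x at_within_interior[of x "{x/2..b}"] by (simp add: interior_atLeastAtMost_real)
qed

lemma continuous_on_sol:
  assumes g: "admissible g"
  shows "continuous_on {0<..<b} (sol a c g)" "continuous_on {0<..<b} (sol' a c g)"
proof -
  have "continuous_on {0<..b} (sol a c g) \<and> continuous_on {0<..b} (sol' a c g)"
  proof -
    have "continuous (at x within {0<..b}) (sol a c g)" "continuous (at x within {0<..b}) (sol' a c g)"
      if x: "x \<in> {0<..b}" for x
    proof -
      have "continuous (at x within {x/2..b}) (sol a c g)" "continuous (at x within {x/2..b}) (sol' a c g)"
        using AC_on_continuous[OF AC_on_sol(1)[OF g, of "x/2" a c]]
          AC_on_continuous[OF AC_on_sol(2)[OF g, of "x/2" a c]] x
        by (auto simp: continuous_on_eq_continuous_within)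
      moreover have "at x within {x/2..b} = at x within {0<..b}"
        by (rule at_within_nhd[of _ "{x/2<..}"]) (use x in auto)
      ultimately show "continuous (at x within {0<..b}) (sol a c g)"
        "continuous (at x within {0<..b}) (sol' a c g)" by simp_all
    qed
    then show ?thesis by (simp add: continuous_on_eq_continuous_within)
  qed
  then show "continuous_on {0<..<b} (sol a c g)" "continuous_on {0<..<b} (sol' a c g)"
    by (auto elim: continuous_on_subset)
qed

lemma sol_L2:
  assumes g: "admissible g"
  shows "sol a c g \<in> L2 b"
proof -
  have "(\<lambda>x. coef_F a g x * of_real (F x) + coef_G c g x * of_real (G x)) \<in> L2 b"
    by (intro L2_add L2_continuous_mult solutions_L2 AC_on_continuous[OF AC_on_coeffs(1)]
        AC_on_continuous[OF AC_on_coeffs(2)] g)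
  then show ?thesis by (simp add: sol_def[abs_def] mult.commute)
qed

text \<open>
  Let \<open>p\<close>, \<open>r\<close> be the coefficients of \<open>f = sol a c g\<close> and \<open>p\<^sub>0\<close>, \<open>r\<^sub>0\<close> those of \<open>u = sol 0 0 v\<close>. The
  difference of the two integrands is the derivative of the bracket \<open>r\<^sub>0 cnj p - p\<^sub>0 cnj r\<close>. The
  bracket vanishes at \<open>0\<close> because \<open>p\<^sub>0\<close> and \<open>r\<^sub>0\<close> do, and at \<open>b\<close> because \<open>u\<close> and \<open>f\<close> vanish there.
\<close>

lemma Lagrange_identity:
  assumes v: "admissible v" and g: "admissible g"
    and v0: "sol 0 0 v b = 0" and g0: "sol a c g b = 0"
  shows "(\<lambda>x. v x * cnj (sol a c g x)) absolutely_integrable_on {0..b}"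
    and "(\<lambda>x. sol 0 0 v x * cnj (g x)) absolutely_integrable_on {0..b}"
    and "integral {0..b} (\<lambda>x. v x * cnj (sol a c g x)) = integral {0..b} (\<lambda>x. sol 0 0 v x * cnj (g x))"
proof -
  note vc = AC_on_coeffs[OF v] and gc = AC_on_coeffs[OF g, THEN AC_on_cnj]
  have vF: "(\<lambda>x. of_real (F x) * v x) absolutely_integrable_on {0..b}"
    and vG: "(\<lambda>x. of_real (G x) * v x) absolutely_integrable_on {0..b}"
    using v unfolding admissible_def by blast+
  have gF: "(\<lambda>x. cnj (of_real (F x) * g x)) absolutely_integrable_on {0..b}"
    and gG: "(\<lambda>x. cnj (of_real (G x) * g x)) absolutely_integrable_on {0..b}"
    using AC_on_integrable[OF gc(2)] AC_on_integrable[OF AC_on_cmult[OF gc(1), of "-1"]] by simp_all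
  have "(\<lambda>x. (of_real (F x) * v x) * cnj (coef_F a g x) + (of_real (G x) * v x) * cnj (coef_G c g x))
      absolutely_integrable_on {0..b}"
    by (intro set_integral_add absolutely_integrable_mult_continuous(2)[OF AC_on_continuous[OF gc(1)] vF]
        absolutely_integrable_mult_continuous(2)[OF AC_on_continuous[OF gc(2)] vG])
  then show L: "(\<lambda>x. v x * cnj (sol a c g x)) absolutely_integrable_on {0..b}"
    by (simp add: sol_def algebra_simps)
  have "(\<lambda>x. coef_F 0 v x * cnj (of_real (F x) * g x) + coef_G 0 v x * cnj (of_real (G x) * g x))
      absolutely_integrable_on {0..b}"
    by (intro set_integral_add absolutely_integrable_mult_continuous(1)[OF AC_on_continuous[OF vc(1)] gF]
        absolutely_integrable_mult_continuous(1)[OF AC_on_continuous[OF vc(2)] gG])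
  then show R: "(\<lambda>x. sol 0 0 v x * cnj (g x)) absolutely_integrable_on {0..b}"
    by (simp add: sol_def algebra_simps)
  define B where "B x = coef_G 0 v x * cnj (coef_F a g x) - coef_F 0 v x * cnj (coef_G c g x)" for x
  have "AC_on 0 b B (\<lambda>x. ((of_real (F x) * v x) * cnj (coef_F a g x) + coef_G 0 v x * cnj (- (of_real (G x) * g x)))
     - (- (of_real (G x) * v x) * cnj (coef_G c g x) + coef_F 0 v x * cnj (of_real (F x) * g x)))"
    unfolding B_def[abs_def] by (intro AC_on_diff AC_on_mult vc gc)
  then have "AC_on 0 b B (\<lambda>x. v x * cnj (sol a c g x) - sol 0 0 v x * cnj (g x))"
    by (rule AC_on_cong) (use b in \<open>simp_all add: sol_def algebra_simps\<close>)
  from AC_on_integral[OF this, of 0 b] b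
  have "integral {0..b} (\<lambda>x. v x * cnj (sol a c g x) - sol 0 0 v x * cnj (g x)) = B b - B 0"
    by simp
  moreover have "B 0 = 0" by (simp add: B_def)
  moreover have "B b = 0"
  proof -
    have gb: "of_real (F b) * cnj (coef_F a g b) = - (of_real (G b) * cnj (coef_G c g b))"
      using arg_cong[OF g0, of cnj] by (simp add: sol_def add_eq_0_iff)
    have "of_real (F b) * B b = coef_G 0 v b * (of_real (F b) * cnj (coef_F a g b)) - of_real (F b) * coef_F 0 v b * cnj (coef_G c g b)"
      by (simp add: B_def algebra_simps)
    also have "\<dots> = - (sol 0 0 v b * cnj (coef_G c g b))"
      unfolding gb by (simp add: sol_def algebra_simps)
    finally show ?thesis using v0 reg_pos[OF b, of \<nu>] by simp
  qed
  ultimately show "integral {0..b} (\<lambda>x. v x * cnj (sol a c g x)) = integral {0..b} (\<lambda>x. sol 0 0 v x * cnj (g x))"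
    using L R by (simp add: Henstock_Kurzweil_Integration.integral_diff set_lebesgue_integral_eq_integral(1))
qed

section \<open>The domain of the minimal operator\<close>

text \<open>
  The bracket of \<open>\<phi>\<close> with a solution \<open>S\<close> of the homogeneous equation has density \<open>S v\<close>, where
  \<open>v = q \<phi> - \<phi>2\<close>. By the growth bounds its boundary term at \<open>0\<close> is of order \<open>x\<^bsup>1-\<mu>\<^esup>\<close>, and \<open>S q \<phi>\<close> is of
  order \<open>x\<^bsup>-\<mu>\<^esup>\<close>, so the identity holds up to \<open>0\<close>.
\<close>

lemma minimal_domain_bracket:
  fixes S S' :: "real \<Rightarrow> real"
  assumes H2: "H2_fun b \<phi> \<phi>1 \<phi>2" and \<phi>: "\<phi> 0 = 0" "\<phi>1 0 = 0"
    and AC: "\<And>s. 0 < s \<Longrightarrow> AC_on s b (\<lambda>x. of_real (S x)) (\<lambda>x. of_real (S' x))"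
      "\<And>s. 0 < s \<Longrightarrow> AC_on s b (\<lambda>x. of_real (S' x)) (\<lambda>x. of_real (q x * S x))"
    and L2: "(\<lambda>x. of_real (S x)) \<in> L2 b" and \<mu>: "\<mu> < 1" "0 \<le> C"
    and bS: "\<And>x. 0 < x \<Longrightarrow> x \<le> b \<Longrightarrow> \<bar>S x\<bar> \<le> C * x powr (1/2 - \<mu>)"
    and bS': "\<And>x. 0 < x \<Longrightarrow> x \<le> b \<Longrightarrow> \<bar>S' x\<bar> \<le> C * x powr (- 1/2 - \<mu>)"
  shows "AC_on 0 b (\<lambda>x. \<phi> x * of_real (S' x) - \<phi>1 x * of_real (S x))
           (\<lambda>x. of_real (S x) * (of_real (q x) * \<phi> x - \<phi>2 x))"
proof (rule AC_on_extend_left)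
  obtain K where K: "0 \<le> K" "\<And>x. 0 < x \<Longrightarrow> x \<le> b \<Longrightarrow> cmod (\<phi>1 x) \<le> K * x powr (1/2)"
    "\<And>x. 0 < x \<Longrightarrow> x \<le> b \<Longrightarrow> cmod (\<phi> x) \<le> K * x powr (3/2)"
    using H2_fun_growth[OF H2 \<phi>] by metis
  note ACH = H2_fun_AC[OF H2]
  show "0 < b" by (rule b)
  show "AC_on e b (\<lambda>x. \<phi> x * of_real (S' x) - \<phi>1 x * of_real (S x))
           (\<lambda>x. of_real (S x) * (of_real (q x) * \<phi> x - \<phi>2 x))" if e: "0 < e" "e < b" for e
  proof (rule AC_on_cong)
    show "AC_on e b (\<lambda>x. \<phi> x * of_real (S' x) - \<phi>1 x * of_real (S x))
       (\<lambda>x. (\<phi>1 x * of_real (S' x) + \<phi> x * of_real (q x * S x))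
         - (\<phi>2 x * of_real (S x) + \<phi>1 x * of_real (S' x)))"
      using e by (intro AC_on_diff AC_on_mult AC AC_on_subinterval[OF ACH(1)] AC_on_subinterval[OF ACH(2)]) auto
  qed (use e in \<open>simp_all add: algebra_simps\<close>)
  show "((\<lambda>x. \<phi> x * of_real (S' x) - \<phi>1 x * of_real (S x)) \<longlongrightarrow>
      \<phi> 0 * of_real (S' 0) - \<phi>1 0 * of_real (S 0)) (at_right 0)"
    unfolding \<phi> mult_zero_left diff_self
  proof (rule tendsto_at_right_0I[OF b])
    show "0 < 1 - \<mu>" using \<mu> by simp
    fix x assume x: "0 < x" "x \<le> b"
    have "cmod (\<phi> x * of_real (S' x) - \<phi>1 x * of_real (S x)) \<le> cmod (\<phi> x) * \<bar>S' x\<bar> + cmod (\<phi>1 x) * \<bar>S x\<bar>"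
      by (rule order_trans[OF norm_triangle_ineq4]) (simp add: norm_mult)
    also have "\<dots> \<le> (K * x powr (3/2)) * (C * x powr (- 1/2 - \<mu>)) + (K * x powr (1/2)) * (C * x powr (1/2 - \<mu>))"
      using x K \<mu> bS bS' by (intro add_mono mult_mono) auto
    also have "\<dots> = K * C * (x powr (3/2) * x powr (- 1/2 - \<mu>)) + K * C * (x powr (1/2) * x powr (1/2 - \<mu>))"
      by (simp add: algebra_simps)
    also have "\<dots> = (2 * K * C) * x powr (1 - \<mu>)"
      unfolding powr_add[symmetric] by simp
    finally show "cmod (\<phi> x * of_real (S' x) - \<phi>1 x * of_real (S x)) \<le> (2 * K * C) * x powr (1 - \<mu>)" .
  qed
  have "(\<lambda>x. of_real (S x) * (of_real (q x) * \<phi> x)) absolutely_integrable_on {0<..<b}"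
  proof (rule measurable_bounded_by_integrable_imp_absolutely_integrable)
    have "continuous_on {0<..<b} q" unfolding pot_def by (intro continuous_intros) auto
    then have "(\<lambda>x. of_real (q x) * \<phi> x) \<in> borel_measurable (lebesgue_on {0<..<b})"
      by (intro borel_measurable_continuous_Ioo continuous_intros continuous_on_subset[OF AC_on_continuous[OF ACH(1)]]) auto
    then show "(\<lambda>x. of_real (S x) * (of_real (q x) * \<phi> x)) \<in> borel_measurable (lebesgue_on {0<..<b})"
      using L2_measurable[OF L2] by measurable
    show "(\<lambda>x. (C * K * \<bar>\<nu>\<^sup>2 - 1/4\<bar>) * x powr (- \<mu>)) integrable_on {0<..<b}"
      using \<mu> b unfolding integrable_on_Icc_iff_Ioo[symmetric]
      by (intro integrable_on_mult_right integrable_on_powr_from_0) auto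
    show "norm (of_real (S x) * (of_real (q x) * \<phi> x)) \<le> (C * K * \<bar>\<nu>\<^sup>2 - 1/4\<bar>) * x powr (- \<mu>)" if "x \<in> {0<..<b}" for x
    proof -
      have x: "0 < x" "x \<le> b" using that by auto
      have qx: "\<bar>q x\<bar> = \<bar>\<nu>\<^sup>2 - 1/4\<bar> * x powr (-2)"
        using powr_minus_divide[of x 2] x by (simp add: pot_def abs_divide)
      have "norm (of_real (S x) * (of_real (q x) * \<phi> x)) = \<bar>S x\<bar> * (\<bar>q x\<bar> * cmod (\<phi> x))"
        by (simp add: norm_mult)
      also have "\<dots> \<le> (C * x powr (1/2 - \<mu>)) * ((\<bar>\<nu>\<^sup>2 - 1/4\<bar> * x powr (-2)) * (K * x powr (3/2)))"
        unfolding qx using x K \<mu> bS by (intro mult_mono) auto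
      also have "\<dots> = (C * K * \<bar>\<nu>\<^sup>2 - 1/4\<bar>) * ((x powr (1/2 - \<mu>) * x powr (-2)) * x powr (3/2))"
        by (simp only: mult_ac)
      also have "\<dots> = (C * K * \<bar>\<nu>\<^sup>2 - 1/4\<bar>) * x powr (- \<mu>)"
        unfolding powr_add[symmetric] by simp
      finally show ?thesis .
    qed
  qed auto
  then have "(\<lambda>x. of_real (S x) * (of_real (q x) * \<phi> x)) absolutely_integrable_on {0..b}"
    by (simp only: absolutely_integrable_on_Icc_iff_Ioo)
  from set_integral_diff(1)[OF this L2_mult_integrable[OF L2 ACH(3)]]
  show "(\<lambda>x. of_real (S x) * (of_real (q x) * \<phi> x - \<phi>2 x)) absolutely_integrable_on {0..b}"
    by (simp only: right_diff_distrib)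
qed

text \<open>
  The brackets of \<open>\<phi>\<close> with \<open>F\<close> and \<open>G\<close> are, up to sign, the coefficients in the variation of
  parameters, and \<open>\<phi>\<close> is recovered from them because the Wronskian is \<open>1\<close>. The representative \<open>v0\<close>
  is needed because \<open>u\<close> and \<open>v\<close> are determined only almost everywhere.
\<close>

lemma minimal_domain_sol:
  assumes "(u, v) \<in> bessel_min \<nu> b"
  obtains v0 where "AE x in lebesgue_on {0<..<b}. v0 x = v x"
    "AE x in lebesgue_on {0<..<b}. sol 0 0 v0 x = u x"
    "v0 \<in> borel_measurable (lebesgue_on {0<..<b})" "admissible v0" "sol 0 0 v0 b = 0"
proof -
  obtain \<phi> \<phi>1 \<phi>2 where H2: "H2_fun b \<phi> \<phi>1 \<phi>2" and \<phi>: "\<phi> 0 = 0" "\<phi>1 0 = 0" "\<phi> b = 0"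
    and u: "AE x in lebesgue_on {0<..<b}. u x = \<phi> x"
    and v: "AE x in lebesgue_on {0<..<b}. v x = - \<phi>2 x + complex_of_real ((\<nu>\<^sup>2 - 1/4) / x\<^sup>2) * \<phi> x"
    using assms unfolding bessel_min_def mem_Collect_eq case_prod_conv by (elim exE conjE)
  obtain \<mu> C where C: "\<mu> < 1" "0 \<le> C"
    "\<And>x. 0 < x \<Longrightarrow> x \<le> b \<Longrightarrow> \<bar>F x\<bar> \<le> C * x powr (1/2 - \<mu>)"
    "\<And>x. 0 < x \<Longrightarrow> x \<le> b \<Longrightarrow> \<bar>G x\<bar> \<le> C * x powr (1/2 - \<mu>)"
    "\<And>x. 0 < x \<Longrightarrow> x \<le> b \<Longrightarrow> \<bar>F' x\<bar> \<le> C * x powr (- 1/2 - \<mu>)"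
    "\<And>x. 0 < x \<Longrightarrow> x \<le> b \<Longrightarrow> \<bar>G' x\<bar> \<le> C * x powr (- 1/2 - \<mu>)"
    by (rule solution_growth[OF nu b], rule that)
  define v0 where "v0 x = of_real (q x) * \<phi> x - \<phi>2 x" for x
  have ACF: "AC_on 0 b (\<lambda>x. \<phi> x * of_real (F' x) - \<phi>1 x * of_real (F x)) (\<lambda>x. of_real (F x) * v0 x)"
    unfolding v0_def
    by (rule minimal_domain_bracket[OF H2 \<phi>(1,2) AC_on_solutions(1,3) solutions_L2(1) C(1,2,3,5)])
  have ACG: "AC_on 0 b (\<lambda>x. \<phi> x * of_real (G' x) - \<phi>1 x * of_real (G x)) (\<lambda>x. of_real (G x) * v0 x)"
    unfolding v0_def
    by (rule minimal_domain_bracket[OF H2 \<phi>(1,2) AC_on_solutions(2,4) solutions_L2(2) C(1,2,4,6)])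
  have adm: "admissible v0"
    unfolding admissible_def by (intro conjI AC_on_integrable[OF ACF] AC_on_integrable[OF ACG])
  have sol: "sol 0 0 v0 x = \<phi> x" if x: "0 < x" "x \<le> b" for x
  proof -
    have r: "coef_G 0 v0 x = \<phi> x * of_real (F' x) - \<phi>1 x * of_real (F x)"
      using AC_on_integral[OF ACF, of 0 x] x \<phi> by (simp add: coef_G_def)
    have "integral {0..x} (\<lambda>t. of_real (G t) * v0 t) = \<phi> x * of_real (G' x) - \<phi>1 x * of_real (G x)"
      using AC_on_integral[OF ACG, of 0 x] x \<phi> by simp
    then have p: "coef_F 0 v0 x = - (\<phi> x * of_real (G' x) - \<phi>1 x * of_real (G x))"
      by (simp add: coef_F_def)
    have "sol 0 0 v0 x = \<phi> x * (of_real (G x) * of_real (F' x) - of_real (G' x) * of_real (F x))"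
      unfolding sol_def p r by (simp add: algebra_simps)
    then show ?thesis unfolding wronskian_complex[OF x(1)] by simp
  qed
  show ?thesis
  proof (rule that)
    show "AE x in lebesgue_on {0<..<b}. v0 x = v x"
      using v by eventually_elim (simp add: v0_def pot_def)
    show "AE x in lebesgue_on {0<..<b}. sol 0 0 v0 x = u x"
      using u AE_space by eventually_elim (use sol in auto)
    have "continuous_on {0<..<b} q" unfolding pot_def by (intro continuous_intros) auto
    then have "(\<lambda>x. of_real (q x) * \<phi> x) \<in> borel_measurable (lebesgue_on {0<..<b})"
      by (intro borel_measurable_continuous_Ioo continuous_intros
          continuous_on_subset[OF AC_on_continuous[OF H2_fun_AC(1)[OF H2]]]) auto
    then show "v0 \<in> borel_measurable (lebesgue_on {0<..<b})"
      unfolding v0_def[abs_def] using L2_measurable[OF H2_fun_AC(3)[OF H2]] by measurable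
    show "sol 0 0 v0 b = 0" using sol[OF b] \<phi> by simp
  qed (rule adm)
qed

section \<open>The adjoint\<close>

lemma sol_in_adjoint:
  assumes g: "g \<in> L2 b" and g0: "sol a c g b = 0"
    and f: "AE x in lebesgue_on {0<..<b}. sol a c g x = f x"
  shows "(f, g) \<in> adjoint_graph b (bessel_min \<nu> b)"
proof -
  note adm = admissible_L2[OF g]
  have L2: "sol a c g \<in> L2 b" by (rule sol_L2[OF adm])
  have "ip b v f = ip b u g" if uv: "(u, v) \<in> bessel_min \<nu> b" for u v
  proof -
    obtain v0 where v0: "AE x in lebesgue_on {0<..<b}. v0 x = v x"
      "AE x in lebesgue_on {0<..<b}. sol 0 0 v0 x = u x"
      "v0 \<in> borel_measurable (lebesgue_on {0<..<b})" "admissible v0" "sol 0 0 v0 b = 0"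
      by (rule minimal_domain_sol[OF uv], rule that)
    note Lag = Lagrange_identity[OF v0(4) adm v0(5) g0]
    have "ip b v f = ip b v0 (sol a c g)"
      by (rule ip_cong_AE[symmetric]) (use v0 f L2_measurable[OF L2] in auto)
    also have "\<dots> = ip b (sol 0 0 v0) g"
      using Lag by (simp add: ip_eq_integral)
    also have "\<dots> = ip b u g"
      by (rule ip_cong_AE) (use v0 L2_measurable[OF g] L2_measurable[OF sol_L2[OF v0(4)]] in auto)
    finally show ?thesis .
  qed
  then show ?thesis
    using L2_cong_AE[OF L2 f] g by (auto simp: adjoint_graph_def)
qed

text \<open>
  If \<open>v\<close> vanishes near \<open>0\<close>, so does \<open>sol 0 0 v\<close>, and no singularity is left. These right-hand sides
  are plentiful enough to determine the adjoint.
\<close>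

lemma sol_in_minimal:
  assumes v: "v \<in> L2 b" and \<epsilon>: "0 < \<epsilon>" "\<epsilon> < b" and v0: "\<And>x. x \<le> \<epsilon> \<Longrightarrow> v x = 0"
    and vb: "sol 0 0 v b = 0"
  shows "(sol 0 0 v, v) \<in> bessel_min \<nu> b"
proof -
  note adm = admissible_L2[OF v]
  have zero: "coef_F 0 v x = 0" "coef_G 0 v x = 0" if "x \<le> \<epsilon>" for x
  proof -
    have "integral {0..x} (\<lambda>t. of_real (F t) * v t) = integral {0..x} (\<lambda>t. 0)"
      "integral {0..x} (\<lambda>t. - (of_real (G t) * v t)) = integral {0..x} (\<lambda>t. 0)"
      by (rule Henstock_Kurzweil_Integration.integral_cong, use that v0 in simp)+
    then show "coef_F 0 v x = 0" "coef_G 0 v x = 0" by (simp_all add: coef_F_def coef_G_def)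
  qed
  have cont_max: "continuous_on {0..b} (\<lambda>x. complex_of_real (H (max x \<epsilon>)))"
    if "continuous_on {\<epsilon>..b} H" for H
    by (rule continuous_on_of_real, rule continuous_on_compose2[OF that])
       (use \<epsilon> in \<open>auto intro!: continuous_intros\<close>)
  note cont_pr = AC_on_continuous[OF AC_on_coeffs(1)[OF adm, of 0]] AC_on_continuous[OF AC_on_coeffs(2)[OF adm, of 0]]
  have comb: "continuous_on {0..b} (\<lambda>x. of_real (H x) * coef_F 0 v x + of_real (K x) * coef_G 0 v x)"
    if "continuous_on {\<epsilon>..b} H" "continuous_on {\<epsilon>..b} K" for H K :: "real \<Rightarrow> real"
  proof -
    have "continuous_on {0..b} (\<lambda>x. of_real (H (max x \<epsilon>)) * coef_F 0 v x + of_real (K (max x \<epsilon>)) * coef_G 0 v x)"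
      by (intro continuous_intros cont_max that cont_pr)
    then show ?thesis
      by (rule continuous_on_eq) (use zero in \<open>auto simp: max_def\<close>)
  qed
  have cs: "continuous_on {0..b} (sol 0 0 v)" "continuous_on {0..b} (sol' 0 0 v)"
    unfolding sol_def[abs_def] sol'_def[abs_def]
    by (intro comb continuous_on_solutions \<epsilon>)+
  have lim: "(A \<longlongrightarrow> A 0) (at_right 0)" if "continuous_on {0..b} A" for A :: "real \<Rightarrow> complex"
    using that b by (metis at_within_Icc_at_right atLeastAtMost_iff continuous_on_def less_eq_real_def order_refl)
  define \<phi>2 where "\<phi>2 x = of_real (q x) * sol 0 0 v x - v x" for x
  \<comment> \<open>Left of \<open>\<epsilon>\<close> the coefficients vanish, so the singular factors may be frozen at \<open>\<epsilon>\<close>.\<close>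
  have qs: "continuous_on {0..b} (\<lambda>x. of_real (q x) * sol 0 0 v x)"
  proof -
    have "continuous_on {0..b} (\<lambda>x. of_real (q (max x \<epsilon>)) * sol 0 0 v x)"
      by (intro continuous_intros cont_max cs continuous_on_pot \<epsilon>)
    then show ?thesis
      by (rule continuous_on_eq) (use zero in \<open>auto simp: max_def sol_def\<close>)
  qed
  have \<phi>2: "\<phi>2 \<in> L2 b"
    unfolding \<phi>2_def[abs_def] by (intro L2_diff v L2_continuous qs)
  have AC1: "AC_on 0 b (sol 0 0 v) (sol' 0 0 v)"
  proof (rule AC_on_extend_left[OF b])
    show "AC_on e b (sol 0 0 v) (sol' 0 0 v)" if "0 < e" "e < b" for e
      using AC_on_sol(1)[OF adm, of e] that by simp
  qed (intro lim cs absolutely_integrable_continuous_real)+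
  have AC2: "AC_on 0 b (sol' 0 0 v) \<phi>2"
  proof (rule AC_on_extend_left[OF b])
    show "AC_on e b (sol' 0 0 v) \<phi>2" if "0 < e" "e < b" for e
      using AC_on_sol(2)[OF adm, of e 0 0] that by (simp add: \<phi>2_def[abs_def])
  qed (intro lim cs L2_integrable \<phi>2)+
  have "H2_fun b (sol 0 0 v) (sol' 0 0 v) \<phi>2"
    unfolding H2_fun_def
  proof (intro conjI ballI)
    fix x assume x: "x \<in> {0..b}"
    show "(sol 0 0 v has_vector_derivative sol' 0 0 v x) (at x within {0..b})"
      by (rule AC_on_has_vector_derivative[OF AC1 cs(2) x])
    have "integral\<^sup>L (lebesgue_on {0<..<x}) \<phi>2 = integral {0..x} \<phi>2"
      by (rule LINT_Ioo_eq_integral, rule absolutely_integrable_on_subinterval[OF AC_on_integrable[OF AC2]])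
         (use x in auto)
    then show "sol' 0 0 v x = sol' 0 0 v 0 + integral\<^sup>L (lebesgue_on {0<..<x}) \<phi>2"
      using AC_on_integral[OF AC2, of 0 x] x by simp
  qed (rule \<phi>2)
  moreover have "sol 0 0 v 0 = 0" "sol' 0 0 v 0 = 0"
    by (simp_all add: sol_def sol'_def)
  moreover have "v x = - \<phi>2 x + complex_of_real ((\<nu>\<^sup>2 - 1/4) / x\<^sup>2) * sol 0 0 v x" for x
    by (simp add: \<phi>2_def pot_def)
  ultimately show ?thesis
    unfolding bessel_min_def mem_Collect_eq case_prod_conv using vb
    by (intro exI[of _ "sol 0 0 v"] exI[of _ "sol' 0 0 v"] exI[of _ \<phi>2] conjI AE_I2) simp_all
qed

definition \<kappa> :: real where "\<kappa> = G b / F b"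

definition w :: "real \<Rightarrow> real" where "w x = G x - \<kappa> * F x"

lemma w_pos: "0 < x \<Longrightarrow> x < b \<Longrightarrow> 0 < w x"
  using sing_over_reg_decreasing[OF nu(1), of x b] reg_pos[of x \<nu>]
  unfolding w_def \<kappa>_def by (simp add: pos_less_divide_eq)

lemma w_b: "w b = 0"
  using reg_pos[OF b, of \<nu>] by (simp add: w_def \<kappa>_def)

lemma w_L2: "(\<lambda>x. complex_of_real (w x)) \<in> L2 b"
  using L2_diff[OF solutions_L2(2) L2_cmult[OF solutions_L2(1)]] by (simp add: w_def)

lemma sol_affine: "sol a c g x = sol 0 0 g x + of_real (F x) * a + of_real (G x) * c"
  by (simp add: sol_def coef_F_def coef_G_def algebra_simps)

text \<open>
  The value of \<open>sol 0 0 v\<close> at \<open>b\<close> is \<open>-F(b)\<close> times the integral of \<open>w v\<close>. Hence, by \<open>sol_in_minimal\<close>, a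
  right-hand side that vanishes near \<open>0\<close> is in the range of the minimal operator if it is
  orthogonal to \<open>w\<close>.
\<close>

lemma sol_zero_at_b_iff:
  assumes v: "v \<in> L2 b"
  shows "sol 0 0 v b = 0 \<longleftrightarrow> ip b v (\<lambda>x. of_real (w x)) = 0"
proof -
  have vF: "(\<lambda>x. of_real (F x) * v x) integrable_on {0..b}" and vG: "(\<lambda>x. of_real (G x) * v x) integrable_on {0..b}"
    by (intro set_lebesgue_integral_eq_integral(1) L2_mult_integrable solutions_L2 v)+
  have "ip b v (\<lambda>x. of_real (w x)) = integral {0..b} (\<lambda>x. of_real (G x) * v x - of_real \<kappa> * (of_real (F x) * v x))"
    using L2_mult_integrable[OF v w_L2]
    by (simp add: ip_eq_integral) (simp add: w_def algebra_simps)
  also have "\<dots> = - coef_F 0 v b - of_real \<kappa> * coef_G 0 v b"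
    using vF vG by (simp add: Henstock_Kurzweil_Integration.integral_diff integrable_on_mult_right coef_F_def coef_G_def)
  finally have "of_real (F b) * ip b v (\<lambda>x. of_real (w x)) = - sol 0 0 v b"
    using reg_pos[OF b, of \<nu>] by (simp add: sol_def \<kappa>_def field_simps)
  then show ?thesis using reg_pos[OF b, of \<nu>] by (metis add.inverse_neutral minus_equation_iff mult_eq_0_iff mult_zero_right of_real_eq_0_iff less_irrefl)
qed

text \<open>
  Subtract from \<open>f\<close> a multiple of \<open>w\<close> so that the difference \<open>d\<close> is orthogonal to one fixed function
  \<open>v0\<close>, the restriction of \<open>w\<close> to \<open>(b/2,b)\<close>. The restriction of \<open>d\<close> to \<open>(e,b)\<close> becomes
  orthogonal to \<open>w\<close> after subtracting a multiple of \<open>v0\<close>, so it may be used as a test function;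
  the result is that \<open>d\<close> has norm \<open>0\<close> on \<open>(e,b)\<close>.
\<close>

lemma orthogonal_to_range_imp_w:
  assumes f: "f \<in> L2 b"
    and orth: "\<And>v e. v \<in> L2 b \<Longrightarrow> 0 < e \<Longrightarrow> e < b \<Longrightarrow> (\<And>x. x \<le> e \<Longrightarrow> v x = 0) \<Longrightarrow>
      ip b v (\<lambda>x. of_real (w x)) = 0 \<Longrightarrow> ip b v f = 0"
  obtains l where "AE x in lebesgue_on {0<..<b}. f x = l * of_real (w x)"
proof -
  let ?w = "\<lambda>x. complex_of_real (w x)"
  define v0 where "v0 x = (if b / 2 < x then ?w x else 0)" for x
  have v0: "v0 \<in> L2 b" unfolding v0_def[abs_def] by (rule L2_restrict[OF w_L2])
  define n where "n = ip b v0 ?w"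
  have n: "n \<noteq> 0"
  proof
    assume "n = 0"
    have "ip b v0 v0 = n"
      unfolding n_def ip_def by (rule Bochner_Integration.integral_cong) (auto simp: v0_def)
    then have "AE x in lebesgue_on {0<..<b}. v0 x = 0"
      using ip_self_eq_0_imp_AE[OF v0] \<open>n = 0\<close> by simp
    moreover have "w x \<noteq> 0" if "b/2 < x" "x < b" for x
      using w_pos[of x] that b by auto
    ultimately have "AE x in lebesgue. x \<notin> {b/2<..<b}"
      using b by (auto simp: AE_restrict_space_iff v0_def elim!: eventually_mono)
    then have "{b/2<..<b} \<in> null_sets lebesgue" by (subst AE_iff_null_sets) auto
    then have "negligible {b/2<..<b}" by (simp add: negligible_iff_null_sets)
    then show False using open_not_negligible[of "{b/2<..<b}"] b by auto
  qed
  define l where "l = cnj (ip b v0 f / n)"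
  define d where "d x = f x - l * ?w x" for x
  have d: "d \<in> L2 b" unfolding d_def[abs_def] by (intro L2_diff L2_cmult f w_L2)
  have ip_d: "ip b v d = ip b v f - cnj l * ip b v ?w" if "v \<in> L2 b" for v
    unfolding d_def[abs_def] using that f w_L2 by (simp add: ip_diff_right ip_cmult_right L2_cmult)
  have v0d: "ip b v0 d = 0" using n by (simp add: ip_d[OF v0] l_def flip: n_def)
  have zero: "AE x in lebesgue_on {0<..<b}. e < x \<longrightarrow> d x = 0" if e: "0 < e" "e < b / 2" for e
  proof -
    define de where "de x = (if e < x then d x else 0)" for x
    have de: "de \<in> L2 b" unfolding de_def[abs_def] by (rule L2_restrict[OF d])
    define s where "s = ip b de ?w / n"
    define v where "v x = de x - s * v0 x" for x
    have v: "v \<in> L2 b" unfolding v_def[abs_def] by (intro L2_diff L2_cmult de v0)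
    have "ip b v ?w = ip b de ?w - s * n"
      unfolding v_def[abs_def] n_def using w_L2 de v0
      by (simp add: ip_diff_left ip_cmult_left L2_cmult)
    then have vw: "ip b v ?w = 0" using n by (simp add: s_def)
    have "ip b v f = 0"
      by (rule orth[OF v e(1)]) (use e vw in \<open>auto simp: v_def de_def v0_def\<close>)
    then have "ip b v d = 0" using ip_d[OF v] vw by simp
    then have "ip b de d = 0"
      unfolding v_def[abs_def] using d de v0 v0d by (simp add: ip_diff_left ip_cmult_left L2_cmult)
    moreover have "ip b de de = ip b de d"
      unfolding ip_def by (rule Bochner_Integration.integral_cong) (auto simp: de_def)
    ultimately have "AE x in lebesgue_on {0<..<b}. de x = 0"
      using ip_self_eq_0_imp_AE[OF de] by simp
    then show ?thesis by eventually_elim (auto simp: de_def split: if_splits)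
  qed
  have "AE x in lebesgue_on {0<..<b}. \<forall>n. b / (real n + 3) < x \<longrightarrow> d x = 0"
    unfolding AE_all_countable
  proof
    show "AE x in lebesgue_on {0<..<b}. b / (real n + 3) < x \<longrightarrow> d x = 0" for n
      using b by (intro zero divide_pos_pos divide_strict_left_mono) auto
  qed
  moreover have "AE x in lebesgue_on {0<..<b}. 0 < x"
    by (rule AE_I2) auto
  ultimately have "AE x in lebesgue_on {0<..<b}. f x = l * ?w x"
  proof eventually_elim
    case (elim x)
    \<comment> \<open>The points \<open>b / (n + 3)\<close> lie below \<open>b / 2\<close> and tend to \<open>0\<close>.\<close>
    obtain n :: nat where "b / x < real n" using reals_Archimedean2 by blast
    then have "b < real n * x" using elim(2) by (simp add: pos_divide_less_eq)
    also have "\<dots> \<le> (real n + 3) * x" using elim(2) by (simp add: mult_right_mono)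
    finally have "b / (real n + 3) < x" by (simp add: pos_divide_less_eq mult.commute)
    then show ?case using elim(1) by (auto simp: d_def)
  qed
  then show ?thesis by (rule that)
qed

text \<open>
  Let \<open>sol a0 0 g\<close> be the particular solution that vanishes at \<open>b\<close>. By the Lagrange identity it
  pairs with the range of the minimal operator in the same way as \<open>f\<close>, so \<open>f\<close> differs from it by a multiple of \<open>w\<close>.
\<close>

lemma adjoint_domain:
  assumes adj: "(f, g) \<in> adjoint_graph b (bessel_min \<nu> b)"
  obtains a c where "g \<in> L2 b" "sol a c g b = 0" "AE x in lebesgue_on {0<..<b}. sol a c g x = f x"
proof -
  have f: "f \<in> L2 b" and g: "g \<in> L2 b"
    and ip: "\<And>u v. (u, v) \<in> bessel_min \<nu> b \<Longrightarrow> ip b v f = ip b u g"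
    using adj by (auto simp: adjoint_graph_def)
  note adm = admissible_L2[OF g]
  define a0 where "a0 = - sol 0 0 g b / of_real (F b)"
  have a0: "sol a0 0 g b = 0"
    using reg_pos[OF b, of \<nu>] unfolding sol_affine[of a0] by (simp add: a0_def)
  have L2: "sol a0 0 g \<in> L2 b" by (rule sol_L2[OF adm])
  obtain l where l: "AE x in lebesgue_on {0<..<b}. f x - sol a0 0 g x = l * of_real (w x)"
  proof (rule orthogonal_to_range_imp_w)
    show "(\<lambda>x. f x - sol a0 0 g x) \<in> L2 b" by (intro L2_diff f L2)
    fix v e assume v: "v \<in> L2 b" and e: "0 < e" "e < b" "\<And>x. x \<le> e \<Longrightarrow> v x = 0"
      and vw: "ip b v (\<lambda>x. of_real (w x)) = 0"
    have vb: "sol 0 0 v b = 0" using sol_zero_at_b_iff[OF v] vw by simp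
    have "ip b v f = ip b (sol 0 0 v) g"
      by (rule ip, rule sol_in_minimal[OF v e(1,2) _ vb]) (rule e(3))
    also have "\<dots> = ip b v (sol a0 0 g)"
      using Lagrange_identity[OF admissible_L2[OF v] adm vb a0] by (simp add: ip_eq_integral)
    finally show "ip b v (\<lambda>x. f x - sol a0 0 g x) = 0"
      by (simp add: ip_diff_right f L2 v)
  qed
  show ?thesis
  proof (rule that[OF g])
    have "sol (a0 - \<kappa> * l) l g x = sol a0 0 g x + l * of_real (w x)" for x
      unfolding sol_affine[of "a0 - \<kappa> * l"] sol_affine[of a0] by (simp add: w_def algebra_simps)
    then show "sol (a0 - \<kappa> * l) l g b = 0" "AE x in lebesgue_on {0<..<b}. sol (a0 - \<kappa> * l) l g x = f x"
      using l a0 w_b by (auto elim!: eventually_mono simp: algebra_simps)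
  qed
qed

section \<open>Boundary values\<close>

text \<open>
  The representative chosen by \<open>C1_rep\<close> is unique on \<open>(0,b)\<close>, so it is the one given by variation
  of parameters, whose derivative is known.
\<close>

lemma C1_rep_sol:
  assumes g: "admissible g" and f: "AE x in lebesgue_on {0<..<b}. sol a c g x = f x"
  shows "x \<in> {0<..<b} \<Longrightarrow> C1_rep b f x = sol a c g x"
proof -
  have "sol a c g C1_differentiable_on {0<..<b}"
    unfolding C1_differentiable_on_def
    by (intro exI[of _ "sol' a c g"] conjI ballI sol_deriv[OF g] continuous_on_sol[OF g]) auto
  then have ex: "sol a c g C1_differentiable_on {0<..<b} \<and> (AE x in lebesgue_on {0<..<b}. f x = sol a c g x)"
    using f by (simp add: eq_commute)
  have rep: "C1_rep b f C1_differentiable_on {0<..<b}" "AE x in lebesgue_on {0<..<b}. f x = C1_rep b f x"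
    using someI[of "\<lambda>\<phi>. \<phi> C1_differentiable_on {0<..<b} \<and> (AE x in lebesgue_on {0<..<b}. f x = \<phi> x)", OF ex]
    unfolding C1_rep_def by blast+
  have "AE x in lebesgue_on {0<..<b}. C1_rep b f x = sol a c g x"
    using rep(2) f by eventually_elim simp
  then show "x \<in> {0<..<b} \<Longrightarrow> C1_rep b f x = sol a c g x"
    by (rule continuous_AE_eq_imp_eq[OF C1_differentiable_imp_continuous_on[OF rep(1)] continuous_on_sol(1)[OF g]])
qed

lemma bracket_C1_rep:
  assumes g: "admissible g" and f: "AE x in lebesgue_on {0<..<b}. sol a c g x = f x"
    and x: "0 < x" "x < b" and H: "(H has_real_derivative H') (at x)"
  shows "bracket (C1_rep b f) (\<lambda>x. complex_of_real (H x)) x = sol a c g x * of_real H' - sol' a c g x * of_real (H x)"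
proof -
  have "(C1_rep b f has_vector_derivative sol' a c g x) (at x)"
    by (rule has_vector_derivative_transform_within_open[OF sol_deriv[OF g x], of "{0<..<b}"])
       (use x C1_rep_sol[OF g f] in auto)
  moreover have "((\<lambda>x. complex_of_real (H x)) has_vector_derivative of_real H') (at x)"
    by (rule has_vector_derivative_of_real[OF H])
  ultimately show ?thesis
    using C1_rep_sol[OF g f, of x] x by (simp add: bracket_def vector_derivative_at)
qed

lemma bracket_limit:
  assumes A: "AC_on 0 b A D" and eq: "\<And>x. 0 < x \<Longrightarrow> x < b \<Longrightarrow> bracket f h x = s * A x"
  shows "bracket0 f h = s * A 0"
  unfolding bracket0_def
proof (rule tendsto_Lim)
  have "(A \<longlongrightarrow> A 0) (at 0 within {0..b})"
    using AC_on_continuous[OF A] b by (simp add: continuous_on_def)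
  then have "((\<lambda>x. s * A x) \<longlongrightarrow> s * A 0) (at_right 0)"
    using b by (intro tendsto_intros) (simp add: at_within_Icc_at_right)
  moreover have "\<forall>\<^sub>F x in at_right 0. s * A x = bracket f h x"
    using eventually_at_right_real[OF b] by eventually_elim (simp add: eq)
  ultimately show "(bracket f h \<longlongrightarrow> s * A 0) (at_right 0)"
    by (rule Lim_transform_eventually)
qed (rule trivial_limit_at_right_real)

text \<open>
  On \<open>(0,b)\<close> the brackets with \<open>F\<close> and \<open>G\<close> are exactly \<open>coef_G\<close> and \<open>- coef_F\<close>, so the limits at \<open>0\<close>
  are values of continuous functions.
\<close>

lemma boundary_values:
  assumes g: "admissible g" and f: "AE x in lebesgue_on {0<..<b}. sol a c g x = f x"
  shows "Gamma0 \<nu> b f = c" and "Gamma1 \<nu> b f = a"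
proof -
  have W: "complex_of_real (G x) * of_real (F' x) = 1 + of_real (G' x) * of_real (F x)" if "0 < x" for x
    using wronskian_complex[OF that] by (simp add: algebra_simps)
  have "bracket (C1_rep b f) (\<lambda>x. complex_of_real (F x)) x = 1 * coef_G c g x" if x: "0 < x" "x < b" for x
  proof -
    have "bracket (C1_rep b f) (\<lambda>x. complex_of_real (F x)) x
        = (of_real (G x) * of_real (F' x)) * coef_G c g x - of_real (G' x) * of_real (F x) * coef_G c g x"
      by (subst bracket_C1_rep[OF g f x reg_deriv[OF x(1)]]) (simp add: sol_def sol'_def algebra_simps)
    then show ?thesis unfolding W[OF x(1)] by (simp add: algebra_simps)
  qed
  from bracket_limit[OF AC_on_coeffs(2)[OF g] this]
  show "Gamma0 \<nu> b f = c" by (simp add: Gamma0_def reg_def)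
  have *: "bracket (C1_rep b f) (\<lambda>x. complex_of_real (s * G x)) x = - of_real s * coef_F a g x"
    if x: "0 < x" "x < b" for x s
  proof -
    have "bracket (C1_rep b f) (\<lambda>x. complex_of_real (s * G x)) x
        = of_real s * (of_real (G' x) * of_real (F x) * coef_F a g x - (of_real (G x) * of_real (F' x)) * coef_F a g x)"
      by (subst bracket_C1_rep[OF g f x DERIV_cmult[OF sing_deriv[OF x(1)]]])
         (simp add: sol_def sol'_def algebra_simps)
    then show ?thesis unfolding W[OF x(1)] by (simp add: algebra_simps)
  qed
  have lim: "bracket0 (C1_rep b f) (\<lambda>x. complex_of_real (s * G x)) = - of_real s * a" for s
    using bracket_limit[OF AC_on_coeffs(1)[OF g, of a] *[of _ s]] by simp
  show "Gamma1 \<nu> b f = a"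
  proof (cases "\<nu> = 0")
    case True
    then show ?thesis using lim[of "-1"] by (simp add: Gamma1_def sing_def)
  next
    case False
    then show ?thesis using lim[of "2 * \<nu>"] by (simp add: Gamma1_def sing_def)
  qed
qed

section \<open>The quadratic form\<close>

text \<open>
  The Wronskian \<open>w f' - w' f\<close> of \<open>w\<close> and \<open>f = sol a c g\<close>, in terms of the coefficients of \<open>f\<close>.
\<close>

definition wron where "wron a c g x = coef_F a g x + of_real \<kappa> * coef_G c g x"

lemma AC_on_wron:
  assumes "admissible g"
  shows "AC_on 0 b (wron a c g) (\<lambda>x. - (of_real (w x) * g x))"
  unfolding wron_def[abs_def]
  by (rule AC_on_cong[OF AC_on_add[OF AC_on_coeffs(1)[OF assms, of a] AC_on_cmult[OF AC_on_coeffs(2)[OF assms, of c], where k = "of_real \<kappa>"]]])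
     (use b in \<open>simp_all add: w_def algebra_simps\<close>)

lemma sol_b_eq_wron: "sol a c g b = of_real (F b) * wron a c g b"
  using reg_pos[OF b, of \<nu>] by (simp add: sol_def wron_def \<kappa>_def field_simps)

lemma form_integrable:
  assumes "admissible g"
  shows "(\<lambda>x. of_real (F x * Re (g x * cnj (wron a c g x))) :: complex) absolutely_integrable_on {0..b}"
proof -
  have "(\<lambda>x. (of_real (F x) * g x) * cnj (wron a c g x)) absolutely_integrable_on {0..b}"
    using assms unfolding admissible_def
    by (intro absolutely_integrable_mult_continuous(2)[OF AC_on_continuous[OF AC_on_cnj[OF AC_on_wron[OF assms]]]]) (elim conjE)
  from absolutely_integrable_linear[OF this, of "\<lambda>z. complex_of_real (Re z)"]
  show ?thesis
    using bounded_linear_compose[OF bounded_linear_of_real bounded_linear_Re]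
    by (simp add: o_def mult.assoc)
qed

text \<open>
  With \<open>p = coef_F a g\<close>, \<open>r = coef_G c g\<close> and \<open>m = p + \<kappa> r\<close> one has \<open>g cnj f = r' cnj p - p' cnj r\<close>. Replacing \<open>p\<close> by \<open>m - \<kappa> r\<close> turns it into
  \<open>r' cnj m - m' cnj r\<close>, and this is \<open>2 Re (r' cnj m)\<close> minus the derivative of \<open>m cnj r\<close>.
\<close>

lemma form_value:
  assumes g: "g \<in> L2 b" and gb: "sol a c g b = 0"
  shows "ip b g (sol a c g) = wron a c g 0 * cnj c
    + 2 * integral {0..b} (\<lambda>x. of_real (F x * Re (g x * cnj (wron a c g x))))"
proof -
  note adm = admissible_L2[OF g]
  let ?I = "\<lambda>x. complex_of_real (F x * Re (g x * cnj (wron a c g x)))"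
  let ?D = "\<lambda>x. - (of_real (w x) * g x) * cnj (coef_G c g x) + wron a c g x * cnj (of_real (F x) * g x)"
  have mb: "wron a c g b = 0" using gb reg_pos[OF b, of \<nu>] by (simp add: sol_b_eq_wron)
  have AC: "AC_on 0 b (\<lambda>x. wron a c g x * cnj (coef_G c g x)) ?D"
    by (intro AC_on_mult AC_on_wron AC_on_cnj AC_on_coeffs adm)
  have D: "integral {0..b} ?D = - (wron a c g 0 * cnj c)"
    using AC_on_integral[OF AC, of 0 b] b mb by simp
  have eq: "g x * cnj (sol a c g x) = 2 * ?I x - ?D x" for x
  proof -
    have "2 * ?I x = of_real (F x) * (g x * cnj (wron a c g x) + cnj (g x) * wron a c g x)"
      by (simp only: two_of_real_mult_Re complex_cnj_mult complex_cnj_cnj)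
    then show ?thesis
      by (simp add: sol_def wron_def w_def algebra_simps)
  qed
  have "ip b g (sol a c g) = integral {0..b} (\<lambda>x. 2 * ?I x - ?D x)"
    unfolding ip_eq_integral[OF L2_mult_integrable[OF g L2_cnj[OF sol_L2[OF adm]]]] eq ..
  also have "\<dots> = integral {0..b} (\<lambda>x. 2 * ?I x) - integral {0..b} ?D"
    using form_integrable[OF adm, of a c] AC_on_integrable[OF AC]
    by (intro Henstock_Kurzweil_Integration.integral_diff integrable_on_mult_right set_lebesgue_integral_eq_integral(1))
  finally show ?thesis unfolding D by simp
qed

lemma w_over_F_decreasing:
  assumes "0 < x" "x \<le> y" shows "w y / F y \<le> w x / F x"
proof -
  have "w z / F z = G z / F z - \<kappa>" if "0 < z" for z
    using reg_pos[OF that, of \<nu>] by (simp add: w_def field_simps)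
  then show ?thesis
    using assms sing_over_reg_decreasing[OF nu(1), of x y] by (cases "x = y") auto
qed

text \<open>
  By \<open>w_over_F_decreasing\<close>, \<open>w \<le> (w(y)/F(y)) F\<close> on \<open>[y,b]\<close>; insert this into \<open>m(y) = \<integral> w g\<close> over \<open>[y,b]\<close>.
  The bound makes the boundary term \<open>(F/w) |m|\<^sup>2\<close> vanish at \<open>b\<close>, where \<open>F/w\<close> is unbounded.
\<close>

lemma wron_bound:
  assumes g: "g \<in> L2 b" and gb: "sol a c g b = 0"
  obtains L where "\<And>y. 0 < y \<Longrightarrow> y < b \<Longrightarrow> cmod (wron a c g y) \<le> w y / F y * L"
proof (rule that)
  note adm = admissible_L2[OF g]
  have mb: "wron a c g b = 0" using gb reg_pos[OF b, of \<nu>] by (simp add: sol_b_eq_wron)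
  let ?L = "integral {0..b} (\<lambda>x. cmod (of_real (F x) * g x))"
  have int: "(\<lambda>x. cmod (of_real (F x) * g x)) integrable_on {0..b}"
    using adm unfolding admissible_def by (simp add: absolutely_integrable_on_def)
  fix y assume y: "0 < y" "y < b"
  have iy: "(\<lambda>x. cmod (of_real (F x) * g x)) integrable_on {y..b}"
    by (rule integrable_on_subinterval[OF int]) (use y in auto)
  have wF: "0 \<le> w y / F y" using w_pos[OF y] reg_pos[OF y(1), of \<nu>] by simp
  have "cmod (integral {y..b} (\<lambda>x. - (of_real (w x) * g x))) \<le> integral {y..b} (\<lambda>x. w y / F y * cmod (of_real (F x) * g x))"
  proof (rule integral_norm_bound_integral)
    show "(\<lambda>x. - (of_real (w x) * g x)) integrable_on {y..b}"
      using AC_on_integrable[OF AC_on_subinterval[OF AC_on_wron[OF adm], of y b]] y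
      by (simp add: set_lebesgue_integral_eq_integral(1))
    show "(\<lambda>x. w y / F y * cmod (of_real (F x) * g x)) integrable_on {y..b}"
      by (intro integrable_on_mult_right iy)
    fix x assume x: "x \<in> {y..b}"
    have Fx: "0 < F x" using x y by (intro reg_pos) auto
    have "0 \<le> w x" using w_pos[of x] w_b x y by (cases "x = b") auto
    moreover have "w x \<le> w y / F y * F x"
      using w_over_F_decreasing[of y x] x y Fx by (simp add: pos_divide_le_eq)
    ultimately have "\<bar>w x\<bar> * cmod (g x) \<le> (w y / F y * F x) * cmod (g x)"
      by (intro mult_right_mono) auto
    then show "cmod (- (of_real (w x) * g x)) \<le> w y / F y * cmod (of_real (F x) * g x)"
      using Fx by (simp add: norm_mult mult.assoc)
  qed
  also have "\<dots> = w y / F y * integral {y..b} (\<lambda>x. cmod (of_real (F x) * g x))" by simp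
  also have "\<dots> \<le> w y / F y * ?L"
    using wF y int iy by (intro mult_left_mono integral_subset_le) auto
  finally show "cmod (wron a c g y) \<le> w y / F y * ?L"
    using AC_on_integral[OF AC_on_wron[OF adm, of a c], of y b] y mb by simp
qed

lemma tendsto_w_over_F: "((\<lambda>y. w y / F y) \<longlongrightarrow> 0) (at_left b)"
proof -
  have "continuous_on {b/2..b} (\<lambda>y. w y / F y)"
    unfolding w_def using b reg_pos[of _ \<nu>]
    by (intro continuous_intros continuous_on_solutions) (auto simp: less_imp_neq[symmetric])
  then have "((\<lambda>y. w y / F y) \<longlongrightarrow> w b / F b) (at b within {b/2..b})"
    using b by (simp add: continuous_on_def)
  then show ?thesis using b by (simp add: at_within_Icc_at_left w_b)
qed

lemma F_over_w_deriv:
  assumes x: "0 < x" "x < b"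
  shows "((\<lambda>x. F x / w x) has_real_derivative 1 / (w x)\<^sup>2) (at x)"
proof -
  have "((\<lambda>x. F x / w x) has_real_derivative
      (F' x * w x - F x * (G' x - \<kappa> * F' x)) / (w x * w x)) (at x)"
    unfolding w_def using x w_pos[OF x]
    by (intro DERIV_divide DERIV_diff DERIV_cmult reg_deriv sing_deriv) (auto simp: w_def)
  moreover have "F' x * w x - F x * (G' x - \<kappa> * F' x) = 1"
    using wronskian[OF x(1), of \<nu>] by (simp add: w_def algebra_simps)
  ultimately show ?thesis by (simp add: power2_eq_square)
qed

text \<open>
  Let \<open>\<theta> = F/w\<close> and let \<open>I\<close> be the indefinite integral of the integrand. The function
  \<open>\<theta> |m|\<^sup>2 + 2 I\<close> has density \<open>|m|\<^sup>2 / w\<^sup>2\<close>, so it increases on \<open>(0,b)\<close>. Since \<open>\<theta> |m|\<^sup>2\<close> is non-negative and tends to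
  \<open>0\<close> at \<open>b\<close>, comparing the two ends gives \<open>0 = I(0) \<le> I(b)\<close>.
\<close>

lemma form_nonneg:
  assumes g: "g \<in> L2 b" and gb: "sol a c g b = 0"
  shows "0 \<le> Re (integral {0..b} (\<lambda>x. of_real (F x * Re (g x * cnj (wron a c g x)))))"
proof -
  note adm = admissible_L2[OF g]
  let ?m = "wron a c g"
  let ?D = "\<lambda>x. complex_of_real (F x * Re (g x * cnj (?m x)))"
  define I where "I x = integral {0..x} ?D" for x
  have ACI: "AC_on 0 b I ?D"
    using AC_on_indefinite[OF form_integrable[OF adm, of a c], of 0] by (simp add: I_def[abs_def])
  have step: "2 * Re (I s) \<le> 2 * Re (I y) + F y / w y * (cmod (?m y))\<^sup>2" if sy: "0 < s" "s < y" "y < b" for s y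
  proof -
    define \<theta> where "\<theta> x = F x / w x" for x
    have wnz: "w x \<noteq> 0" if "x \<in> {s..y}" for x using w_pos[of x] that sy by auto
    have cw: "continuous_on {s..y} w"
      unfolding w_def[abs_def] using sy by (intro continuous_intros continuous_on_solutions)
    have AC\<theta>: "AC_on s y (\<lambda>x. of_real (\<theta> x)) (\<lambda>x. of_real (1 / (w x)\<^sup>2))"
      unfolding \<theta>_def using sy wnz
      by (intro AC_on_of_real F_over_w_deriv continuous_intros cw) auto
    have ACm: "AC_on s y ?m (\<lambda>x. - (of_real (w x) * g x))"
      by (rule AC_on_subinterval[OF AC_on_wron[OF adm]]) (use sy in auto)
    define E where "E x = of_real (\<theta> x) * (?m x * cnj (?m x)) + 2 * I x" for x
    have "AC_on s y E (\<lambda>x. (of_real (1 / (w x)\<^sup>2) * (?m x * cnj (?m x))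
        + of_real (\<theta> x) * (- (of_real (w x) * g x) * cnj (?m x) + ?m x * cnj (- (of_real (w x) * g x))))
        + 2 * ?D x)"
      unfolding E_def[abs_def] using sy
      by (intro AC_on_add AC_on_mult[OF AC\<theta>] AC_on_mult[OF ACm] AC_on_cnj[OF ACm]
          AC_on_cmult AC_on_subinterval[OF ACI]) auto
    then have ACE: "AC_on s y E (\<lambda>x. of_real ((cmod (?m x) / w x)\<^sup>2))"
    proof (rule AC_on_cong)
      fix x assume x: "x \<in> {s..y}"
      have D: "2 * ?D x = of_real (F x) * (g x * cnj (?m x) + cnj (g x) * ?m x)"
        by (simp only: two_of_real_mult_Re complex_cnj_mult complex_cnj_cnj)
      have \<theta>w: "complex_of_real (\<theta> x) * of_real (w x) = of_real (F x)"
        using wnz[OF x] by (simp add: \<theta>_def)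
      have "of_real (\<theta> x) * (- (of_real (w x) * g x) * cnj (?m x) + ?m x * cnj (- (of_real (w x) * g x)))
          = - ((of_real (\<theta> x) * of_real (w x)) * (g x * cnj (?m x) + cnj (g x) * ?m x))"
        by (simp add: algebra_simps)
      then have T: "of_real (\<theta> x) * (- (of_real (w x) * g x) * cnj (?m x) + ?m x * cnj (- (of_real (w x) * g x)))
          = - (of_real (F x) * (g x * cnj (?m x) + cnj (g x) * ?m x))"
        unfolding \<theta>w .
      have "complex_of_real (1 / (w x)\<^sup>2) * (?m x * cnj (?m x)) = of_real ((cmod (?m x) / w x)\<^sup>2)"
        unfolding complex_norm_square[symmetric] of_real_mult[symmetric]
        by (simp add: power_divide)
      then show "(of_real (1 / (w x)\<^sup>2) * (?m x * cnj (?m x))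
        + of_real (\<theta> x) * (- (of_real (w x) * g x) * cnj (?m x) + ?m x * cnj (- (of_real (w x) * g x))))
        + 2 * ?D x = of_real ((cmod (?m x) / w x)\<^sup>2)"
        unfolding D T by simp
    qed (use sy in auto)
    have "Re (E y) - Re (E s) = Re (integral {s..y} (\<lambda>x. of_real ((cmod (?m x) / w x)\<^sup>2)))"
      using AC_on_integral[OF ACE, of s y] sy by simp
    also have "\<dots> = integral {s..y} (\<lambda>x. (cmod (?m x) / w x)\<^sup>2)"
      using integral_linear[OF set_lebesgue_integral_eq_integral(1)[OF AC_on_integrable[OF ACE]] bounded_linear_Re]
      by (simp add: o_def)
    also have "\<dots> \<ge> 0"
      by (cases "(\<lambda>x. (cmod (?m x) / w x)\<^sup>2) integrable_on {s..y}")
         (auto intro: Henstock_Kurzweil_Integration.integral_nonneg simp: not_integrable_integral)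
    finally have "Re (E s) \<le> Re (E y)" by simp
    moreover have "Re (E x) = \<theta> x * (cmod (?m x))\<^sup>2 + 2 * Re (I x)" for x
      unfolding E_def complex_norm_square[symmetric] by (simp flip: of_real_mult of_real_power)
    moreover have "0 \<le> \<theta> s" using w_pos[of s] reg_pos[of s \<nu>] sy by (simp add: \<theta>_def)
    ultimately show ?thesis
      using mult_nonneg_nonneg[of "\<theta> s" "(cmod (?m s))\<^sup>2"] by (simp add: \<theta>_def)
  qed
  have contI: "continuous_on {0..b} (\<lambda>x. 2 * Re (I x))"
    by (intro continuous_intros AC_on_continuous[OF ACI])
  then have lim: "((\<lambda>x. 2 * Re (I x)) \<longlongrightarrow> 2 * Re (I x)) (at x within {0..b})" if "x \<in> {0..b}" for x
    using that unfolding continuous_on_def by blast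
  have "I 0 = 0" by (simp add: I_def)
  then have I0: "((\<lambda>s. 2 * Re (I s)) \<longlongrightarrow> 0) (at_right 0)"
    using lim[of 0] b by (simp only: at_within_Icc_at_right[OF b]) simp
  have Ib: "((\<lambda>y. 2 * Re (I y)) \<longlongrightarrow> 2 * Re (I b)) (at_left b)"
    using lim[of b] b by (simp only: at_within_Icc_at_left[OF b]) simp
  have step0: "0 \<le> 2 * Re (I y) + F y / w y * (cmod (?m y))\<^sup>2" if y: "0 < y" "y < b" for y
  proof (rule tendsto_upperbound[OF I0])
    show "\<forall>\<^sub>F s in at_right 0. 2 * Re (I s) \<le> 2 * Re (I y) + F y / w y * (cmod (?m y))\<^sup>2"
      using eventually_at_right_real[OF y(1)] by eventually_elim (use step y in auto)
  qed simp
  obtain L where L: "\<And>y. 0 < y \<Longrightarrow> y < b \<Longrightarrow> cmod (?m y) \<le> w y / F y * L"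
    by (rule wron_bound[OF g gb], rule that)
  have step1: "0 \<le> 2 * Re (I y) + w y / F y * L\<^sup>2" if y: "0 < y" "y < b" for y
  proof -
    have pos: "0 < F y" "0 < w y" using w_pos[OF y] reg_pos[OF y(1), of \<nu>] by auto
    have "F y / w y * (cmod (?m y))\<^sup>2 \<le> F y / w y * (w y / F y * L)\<^sup>2"
      using L[OF y] pos by (intro mult_left_mono power_mono) auto
    also have "\<dots> = w y / F y * L\<^sup>2"
      using pos by (simp add: power2_eq_square field_simps)
    finally show ?thesis using step0[OF y] by linarith
  qed
  have "((\<lambda>y. 2 * Re (I y) + w y / F y * L\<^sup>2) \<longlongrightarrow> 2 * Re (I b) + 0 * L\<^sup>2) (at_left b)"
    by (intro tendsto_intros Ib tendsto_w_over_F)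
  then have "0 \<le> 2 * Re (I b) + 0 * L\<^sup>2"
  proof (rule tendsto_lowerbound)
    show "\<forall>\<^sub>F y in at_left b. 0 \<le> 2 * Re (I y) + w y / F y * L\<^sup>2"
      using eventually_at_left_real[OF b] by eventually_elim (use step1 in auto)
  qed simp
  then show ?thesis by (simp add: I_def)
qed

section \<open>Non-negative extensions\<close>

lemma nonneg_if:
  assumes "- \<kappa> \<le> h"
  shows "nonneg_op b (bessel_ext \<nu> b h)"
  unfolding nonneg_op_def
proof safe
  fix f g assume "(f, g) \<in> bessel_ext \<nu> b h"
  then have adj: "(f, g) \<in> adjoint_graph b (bessel_min \<nu> b)"
    and bc: "Gamma1 \<nu> b f - complex_of_real h * Gamma0 \<nu> b f = 0"
    by (auto simp: bessel_ext_def)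
  obtain a c where g: "g \<in> L2 b" and gb: "sol a c g b = 0"
    and f: "AE x in lebesgue_on {0<..<b}. sol a c g x = f x"
    by (rule adjoint_domain[OF adj], rule that)
  note adm = admissible_L2[OF g]
  have a: "a = of_real h * c"
    using bc boundary_values[OF adm f] by simp
  let ?I = "\<lambda>x. F x * Re (g x * cnj (wron a c g x))"
  note int = integral_of_real_complex[OF set_lebesgue_integral_eq_integral(1)[OF form_integrable[OF adm, of a c]]]
  have "ip b g f = ip b g (sol a c g)"
    using f L2_measurable[OF g] L2_measurable[OF sol_L2[OF adm]]
    by (intro ip_cong_AE[symmetric]) auto
  also have "\<dots> = wron a c g 0 * cnj c + 2 * of_real (integral {0..b} ?I)"
    unfolding form_value[OF g gb] int(2) ..
  also have "wron a c g 0 * cnj c = of_real ((h + \<kappa>) * (cmod c)\<^sup>2)"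
    by (simp add: wron_def a complex_norm_square algebra_simps del: of_real_power)
  finally have "ip b g f = of_real ((h + \<kappa>) * (cmod c)\<^sup>2 + 2 * integral {0..b} ?I)" by simp
  moreover have "0 \<le> integral {0..b} ?I"
    using form_nonneg[OF g gb] unfolding int(2) by simp
  ultimately show "ip b g f \<in> \<real>\<^sub>\<ge>\<^sub>0"
    using assms by (simp only: nonneg_Reals_of_real_iff) simp
qed

text \<open>
  The right-hand side \<open>g\<close> is the indicator function of \<open>(0,d]\<close>, and \<open>d\<close> is chosen so small that \<open>4 e F < w\<close> there,
  where \<open>e = |h + \<kappa>|\<close>. Then \<open>m \<le> M\<close> bounds the second term of the form by \<open>2 M \<integral> F g \<le> M\<^sup>2 / (2 e)\<close>,
  which is half of the first term \<open>-M\<^sup>2 / e\<close> in absolute value.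
\<close>

lemma not_nonneg_if:
  assumes h: "h < - \<kappa>"
  shows "\<not> nonneg_op b (bessel_ext \<nu> b h)"
proof -
  define e where "e = - (h + \<kappa>)"
  have e: "0 < e" using h by (simp add: e_def)
  obtain d0 where d0: "0 < d0" "\<And>x. 0 < x \<Longrightarrow> x < d0 \<Longrightarrow> \<kappa> + 4 * e < G x / F x"
    by (rule sing_over_reg_unbounded[OF nu(1), of "\<kappa> + 4 * e"], rule that)
  define d where "d = min d0 b / 2"
  have d: "0 < d" "d < b" "d < d0" using d0 b by (auto simp: d_def)
  have wF: "4 * e * F x < w x" if "0 < x" "x \<le> d" for x
    using d0(2)[of x] that d reg_pos[of x \<nu>] by (simp add: w_def pos_less_divide_eq algebra_simps)
  define \<gamma> :: "real \<Rightarrow> real" where "\<gamma> x = (if x \<le> d then 1 else 0)" for x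
  define g where "g x = complex_of_real (\<gamma> x)" for x
  have "(\<lambda>x. 1 - (if d < x then 1 else 0)) \<in> L2 b"
    by (intro L2_diff L2_one L2_restrict)
  then have g: "g \<in> L2 b"
    by (rule back_subst[of "\<lambda>f. f \<in> L2 b"]) (auto simp: fun_eq_iff g_def \<gamma>_def)
  note adm = admissible_L2[OF g]
  have wg: "(\<lambda>x. complex_of_real (w x * \<gamma> x)) absolutely_integrable_on {0..b}"
    and Fg: "(\<lambda>x. complex_of_real (F x * \<gamma> x)) absolutely_integrable_on {0..b}"
    using L2_mult_integrable[OF w_L2 g] L2_mult_integrable[OF solutions_L2(1) g] by (simp_all add: g_def)
  note wg' = integral_of_real_complex(1)[OF set_lebesgue_integral_eq_integral(1)[OF wg]]
  note Fg' = integral_of_real_complex(1)[OF set_lebesgue_integral_eq_integral(1)[OF Fg]]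
  define M where "M = integral {0..b} (\<lambda>x. w x * \<gamma> x)"
  define M1 where "M1 = integral {0..b} (\<lambda>x. F x * \<gamma> x)"
  \<comment> \<open>At \<open>x = 0\<close> this holds because \<open>0 powr a = 0\<close> makes \<open>F\<close> and \<open>G\<close> vanish there.\<close>
  have w0: "0 \<le> w x * \<gamma> x" if "x \<in> {0..b}" for x
    using w_pos[of x] that d w_b by (cases "x = 0"; cases "x = b") (auto simp: \<gamma>_def w_def reg_def sing_def)
  have "0 < integral {d/2..d} F"
    using integral_less_real[of "d/2" d "\<lambda>x. 0" F] d reg_pos[of _ \<nu>] continuous_on_solutions(1)[of "d/2" d]
    by simp
  also have "\<dots> = integral {d/2..d} (\<lambda>x. F x * \<gamma> x)"
    by (rule Henstock_Kurzweil_Integration.integral_cong) (auto simp: \<gamma>_def)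
  also have "\<dots> \<le> M1"
    unfolding M1_def using d Fg'
    by (intro integral_subset_le integrable_on_subinterval[OF Fg']) (auto simp: \<gamma>_def reg_def)
  finally have M1: "0 < M1" .
  have "4 * e * M1 = integral {0..b} (\<lambda>x. 4 * e * (F x * \<gamma> x))" by (simp add: M1_def)
  also have "\<dots> \<le> M"
    unfolding M_def
  proof (rule integral_le)
    show "(\<lambda>x. 4 * e * (F x * \<gamma> x)) integrable_on {0..b}" by (intro integrable_on_mult_right Fg')
    show "4 * e * (F x * \<gamma> x) \<le> w x * \<gamma> x" if "x \<in> {0..b}" for x
      using wF[of x] that by (cases "x = 0") (auto simp: \<gamma>_def w_def reg_def sing_def)
  qed (rule wg')
  finally have MM1: "4 * e * M1 \<le> M" .
  then have M: "0 < M" using M1 e by (meson less_le_trans mult_pos_pos zero_less_numeral)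
  \<comment> \<open>The value of \<open>\<Gamma>\<^sub>0 f\<close> for which \<open>m(0) = (h + \<kappa>) c = M\<close>, which makes \<open>f\<close> vanish at \<open>b\<close>.\<close>
  define c where "c = complex_of_real (- M / e)"
  define a where "a = of_real h * c"
  define \<mu> where "\<mu> x = M - integral {0..x} (\<lambda>x. w x * \<gamma> x)" for x
  have m0: "wron a c g 0 = of_real M"
  proof -
    have "wron a c g 0 = of_real (h + \<kappa>) * c" by (simp add: wron_def a_def algebra_simps)
    also have "h + \<kappa> = - e" by (simp add: e_def)
    also have "of_real (- e) * c = of_real M" using e by (simp add: c_def)
    finally show ?thesis .
  qed
  have m: "wron a c g x = of_real (\<mu> x)" if x: "x \<in> {0..b}" for x
  proof -
    have intx: "(\<lambda>x. complex_of_real (w x * \<gamma> x)) integrable_on {0..x}"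
      by (rule integrable_on_subinterval[OF set_lebesgue_integral_eq_integral(1)[OF wg]]) (use x in auto)
    have "wron a c g x - wron a c g 0 = integral {0..x} (\<lambda>x. - complex_of_real (w x * \<gamma> x))"
      using AC_on_integral[OF AC_on_wron[OF adm, of a c], of 0 x] x by (simp add: g_def)
    also have "\<dots> = - integral {0..x} (\<lambda>x. complex_of_real (w x * \<gamma> x))" by simp
    also have "\<dots> = - of_real (integral {0..x} (\<lambda>x. w x * \<gamma> x))"
      by (simp only: integral_of_real_complex(2)[OF intx])
    finally show ?thesis by (simp add: \<mu>_def m0 algebra_simps)
  qed
  have \<mu>: "\<mu> x \<le> M" if x: "x \<in> {0..b}" for x
    unfolding \<mu>_def using x w0
    by (auto intro!: Henstock_Kurzweil_Integration.integral_nonneg integrable_on_subinterval[OF wg'])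
  have gb: "sol a c g b = 0"
    unfolding sol_b_eq_wron using m[of b] b by (simp add: \<mu>_def M_def)
  let ?I = "\<lambda>x. F x * Re (g x * cnj (wron a c g x))"
  note int = integral_of_real_complex[OF set_lebesgue_integral_eq_integral(1)[OF form_integrable[OF adm, of a c]]]
  have "integral {0..b} ?I \<le> integral {0..b} (\<lambda>x. M * (F x * \<gamma> x))"
  proof (rule integral_le)
    show "?I integrable_on {0..b}" by (rule int(1))
    show "(\<lambda>x. M * (F x * \<gamma> x)) integrable_on {0..b}" by (intro integrable_on_mult_right Fg')
    show "?I x \<le> M * (F x * \<gamma> x)" if x: "x \<in> {0..b}" for x
    proof -
      have "F x * \<gamma> x * \<mu> x \<le> F x * \<gamma> x * M"
        using \<mu>[OF x] by (intro mult_left_mono) (auto simp: reg_def \<gamma>_def)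
      then show ?thesis by (simp add: m[OF x] g_def algebra_simps)
    qed
  qed
  also have "\<dots> = M * M1" by (simp add: M1_def)
  finally have I: "integral {0..b} ?I \<le> M * M1" .
  have "ip b g (sol a c g) = wron a c g 0 * cnj c + 2 * of_real (integral {0..b} ?I)"
    unfolding form_value[OF g gb] int(2) ..
  also have "\<dots> = of_real (- (M * M / e) + 2 * integral {0..b} ?I)"
    unfolding m0 by (simp add: c_def)
  finally have val: "ip b g (sol a c g) = of_real (- (M * M / e) + 2 * integral {0..b} ?I)" .
  have "4 * M1 \<le> M / e" using MM1 e by (simp add: pos_le_divide_eq mult.commute mult.left_commute)
  then have "M * (4 * M1) \<le> M * (M / e)" using M by (intro mult_left_mono) auto
  moreover have "0 < M * M1" using M M1 by simp
  ultimately have neg: "- (M * M / e) + 2 * integral {0..b} ?I < 0" using I by simp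
  have mem: "(sol a c g, g) \<in> bessel_ext \<nu> b h"
    using sol_in_adjoint[OF g gb, of "sol a c g"] boundary_values[OF adm, of a c "sol a c g"]
    by (simp add: bessel_ext_def a_def)
  have nonmem: "ip b g (sol a c g) \<notin> \<real>\<^sub>\<ge>\<^sub>0"
    unfolding val using neg by (simp only: nonneg_Reals_of_real_iff)
  show ?thesis
  proof
    assume "nonneg_op b (bessel_ext \<nu> b h)"
    from bspec[OF this[unfolded nonneg_op_def] mem] nonmem show False by simp
  qed
qed

theorem nonneg_iff: "nonneg_op b (bessel_ext \<nu> b h) \<longleftrightarrow> - (G b / F b) \<le> h"
  using nonneg_if[of h] not_nonneg_if[of h] by (cases "- \<kappa> \<le> h") (auto simp: \<kappa>_def)

end

theorem corollary4p6:
  fixes b h :: real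
  assumes "0 < b"
  shows "(\<forall>\<nu>. 0 < \<nu> \<and> \<nu> < 1 \<longrightarrow>
            (nonneg_op b (bessel_ext \<nu> b h) \<longleftrightarrow> h \<ge> - (b powr (- 2 * \<nu>) / (2 * \<nu>)))) \<and>
         (nonneg_op b (bessel_ext 0 b h) \<longleftrightarrow> h \<ge> ln b)"
proof -
  have "nonneg_op b (bessel_ext \<nu> b h) \<longleftrightarrow> - (sing \<nu> b / reg \<nu> b) \<le> h" if "0 \<le> \<nu>" "\<nu> < 1" for \<nu>
    by (intro bessel_interval.nonneg_iff bessel_interval.intro that assms)
  then show ?thesis
    using assms by (simp add: sing_over_reg)
qed

end
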